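(* Let $m=324r^{3}+324r^{2}+108r-231$, where $r>1$ is an integer. Then $3$ divides $h_{4m}$, the class number of the cyclotomic field $\mathbb{Q}(\zeta_{4m})$.
   Context: For a positive integer $N$, $\zeta_{N}$ denotes a primitive $N$-th root of unity. For an integer $m>1$, $h_{4m}$ denotes the class number (order of the ideal class group of the ring of integers) of the cyclotomic field $\mathbb{Q}(\zeta_{4m})$. *)

theory Defs
  imports
    Complex_Main
    "HOL-Algebra.Algebra"
    "HOL-Algebra.Algebraic_Closure_Type"
    "HOL-Computational_Algebra.Polynomial"
begin

text \<open>
  Number fields are subfields \<^term>\<open>K :: complex set\<close> of the complex numbers.
\<close>

definition complex_field :: "complex ring" where
  "complex_field = ring_of_type_algebra"

definition primitive_root_of_unity :: "nat \<Rightarrow> complex \<Rightarrow> bool" where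
  "primitive_root_of_unity N z \<longleftrightarrow> N > 0 \<and> z ^ N = 1 \<and> (\<forall>k. 0 < k \<and> k < N \<longrightarrow> z ^ k \<noteq> 1)"

text \<open>
  \<^term>\<open>generate_field\<close> yields the smallest subfield containing the given set; in
  characteristic zero it contains the rational numbers.
\<close>

definition rationals_adjoin :: "complex \<Rightarrow> complex set" where
  "rationals_adjoin z = generate_field complex_field {z}"

definition ring_of_integers :: "complex set \<Rightarrow> complex ring" where
  "ring_of_integers K = complex_field \<lparr> carrier := {x \<in> K. algebraic_int x} \<rparr>"

text \<open>
  Fractional ideals are the sets \<open>d\<^sup>-\<^sup>1 J\<close> with \<open>J\<close> a nonzero ideal and \<open>d\<close> a nonzero
  element of the ring of integers; in particular the zero ideal is excluded.
\<close>

definition fractional_ideals :: "complex set \<Rightarrow> complex set set" where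
  "fractional_ideals K =
     {(\<lambda>x. x / d) ` J | d J.
        d \<in> carrier (ring_of_integers K) \<and> d \<noteq> 0 \<and> ideal J (ring_of_integers K) \<and> J \<noteq> {0}}"

definition principal_fractional_ideals :: "complex set \<Rightarrow> complex set set" where
  "principal_fractional_ideals K =
     {(\<lambda>x. a * x) ` carrier (ring_of_integers K) | a. a \<in> K \<and> a \<noteq> 0}"

text \<open>
  The product of two fractional ideals consists of the finite sums of products of their
  elements. As \<^term>\<open>ideal_prod\<close> only uses the ring operations, it is taken in the
  ambient field.
\<close>

definition fractional_ideal_group :: "complex set \<Rightarrow> complex set monoid" where
  "fractional_ideal_group K =
     \<lparr> carrier = fractional_ideals K,
       monoid.mult = ideal_prod complex_field,
       one = carrier (ring_of_integers K) \<rparr>"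

definition ideal_class_group :: "complex set \<Rightarrow> complex set set monoid" where
  "ideal_class_group K = fractional_ideal_group K Mod principal_fractional_ideals K"

definition class_number :: "complex set \<Rightarrow> nat" where
  "class_number K = Coset.order (ideal_class_group K)"

end

(*
Write k = 3r + 1 and n = 4k^3 - 81, so m = 3n, and let K be the field of 4m-th roots of unity. It
contains \<alpha> = (9 + sqrt(-n)) / 2, which has trace 9 and norm k^3. As k and 9 are coprime, the ideal
I = (k, \<alpha>) satisfies I^3 = (\<alpha>). Multiplication by I permutes the ideal classes with cube the
identity, so it is enough that it has no fixed point. If IJ = cJ, then v = \<alpha> / c^3 satisfies vJ = J,
so v is a unit and \<alpha> = v c^3.

This is impossible: by Kronecker, u = v / cnj v is a root of unity, and
\<alpha>^2 = (\<alpha> / cnj \<alpha>) k^3 = u (k c / cnj c)^3. Hence \<alpha> = \<delta>^3 in a larger cyclotomic field, which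
then contains the root \<delta> + cnj \<delta> of X^3 - 3kX - 9 and its conjugates. Since a cyclotomic field is
abelian over the rationals, the discriminant 27n of this irreducible cubic is a square, but 3n is not
a square modulo 9.

Irreducibility of the cyclotomic polynomials is not needed: conjugates are taken among the roots of
the minimal polynomial of the root of unity.
*)
theory Submission
  imports Defs "Jordan_Normal_Form.Char_Poly" "HOL-Computational_Algebra.Polynomial"
begin

section \<open>Algebraic integers\<close>

interpretation zmod: Modules.module "\<lambda>(c::int) (x::'a::field_char_0). of_int c * x"
  by unfold_locales (simp_all add: algebra_simps)

lemma algebraic_int_of_finite_module:
  fixes x :: "'a :: field_char_0"
  assumes V: "finite V" "v0 \<in> V" "v0 \<noteq> 0"
    and stable: "\<And>v. v \<in> V \<Longrightarrow> x * v \<in> zmod.span V"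
  shows "algebraic_int x"
proof -
  define n where "n = card V"
  obtain f where f: "bij_betw f {0..<n} V"
    using ex_bij_betw_nat_finite[OF V(1)] unfolding n_def by blast
  have "\<exists>c :: 'a \<Rightarrow> int. x * v = (\<Sum>w\<in>V. of_int (c w) * w)" if "v \<in> V" for v
    using stable[OF that] unfolding zmod.span_finite[OF V(1)] by auto
  then obtain c :: "'a \<Rightarrow> 'a \<Rightarrow> int"
    where c: "\<And>v. v \<in> V \<Longrightarrow> x * v = (\<Sum>w\<in>V. of_int (c v w) * w)" by metis
  define A :: "int mat" where "A = mat n n (\<lambda>(i, j). c (f i) (f j))"
  define B :: "'a mat" where "B = map_mat of_int A"
  have A: "A \<in> carrier_mat n n" and B: "B \<in> carrier_mat n n"
    by (simp_all add: A_def B_def)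
  have fV: "f i \<in> V" if "i < n" for i
    using f that by (auto simp: bij_betw_def)
  have "eigenvector B (vec n f) x"
    unfolding eigenvector_def
  proof (intro conjI)
    show "vec n f \<in> carrier_vec (dim_row B)" using B by simp
    show "vec n f \<noteq> 0\<^sub>v (dim_row B)"
    proof
      assume eq: "vec n f = 0\<^sub>v (dim_row B)"
      obtain i where i: "i < n" "f i = v0"
        using f V(2) by (auto simp: bij_betw_def)
      have "vec n f $ i = 0\<^sub>v (dim_row B) $ i" using eq by simp
      with i B V(3) show False by simp
    qed
    show "B *\<^sub>v vec n f = x \<cdot>\<^sub>v vec n f"
    proof (rule eq_vecI)
      fix i assume "i < dim_vec (x \<cdot>\<^sub>v vec n f)"
      hence i: "i < n" by simp
      have "(B *\<^sub>v vec n f) $ i = (\<Sum>j\<in>{0..<n}. of_int (c (f i) (f j)) * f j)"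
        using i by (simp add: B_def A_def scalar_prod_def)
      also have "\<dots> = (\<Sum>w\<in>V. of_int (c (f i) w) * w)"
        by (rule sum.reindex_bij_betw[OF f])
      also have "\<dots> = x * f i" using c[OF fV[OF i]] by simp
      finally show "(B *\<^sub>v vec n f) $ i = (x \<cdot>\<^sub>v vec n f) $ i" using i by simp
    qed (use B in simp)
  qed
  hence "eigenvalue B x" by (auto simp: eigenvalue_def)
  hence "poly (char_poly B) x = 0" using eigenvalue_root_char_poly[OF B] by simp
  moreover have "char_poly B = map_poly of_int (char_poly A)"
    unfolding B_def by (rule of_int_hom.char_poly_hom[OF A])
  moreover have "lead_coeff (char_poly A) = 1"
    using degree_monic_char_poly[OF A] by simp
  ultimately show ?thesis
    unfolding algebraic_int_altdef_ipoly by auto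
qed

lemma zspan_mult_closed:
  fixes x :: "'a :: field_char_0"
  assumes "\<And>v. v \<in> V \<Longrightarrow> x * v \<in> zmod.span V" "y \<in> zmod.span V"
  shows "x * y \<in> zmod.span V"
  using assms(2)
proof (induction rule: zmod.span_induct_alt)
  case base
  show ?case using zmod.span_zero by simp
next
  case (step c v y)
  have "of_int c * (x * v) + x * y \<in> zmod.span V"
    using step assms(1) by (intro zmod.span_add zmod.span_scale) auto
  thus ?case by (simp add: algebra_simps)
qed

lemma algebraic_int_power_reduce:
  fixes x :: "'a :: field_char_0"
  assumes "algebraic_int x"
  obtains d and c :: "nat \<Rightarrow> int" where "d > 0" "x ^ d = (\<Sum>i<d. of_int (c i) * x ^ i)"
proof -
  obtain p where p: "poly (map_poly of_int p) x = 0" "lead_coeff p = 1"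
    using assms unfolding algebraic_int_altdef_ipoly by auto
  define d where "d = degree p"
  have eq: "(\<Sum>i\<le>d. of_int (coeff p i) * x ^ i) = 0"
    using p(1) by (simp add: poly_altdef d_def degree_map_poly coeff_map_poly)
  moreover have "{..d} = insert d {..<d}" by auto
  ultimately have "x ^ d = (\<Sum>i<d. of_int (- coeff p i) * x ^ i)"
    using p(2) by (simp add: d_def sum_negf add_eq_0_iff2)
  moreover have "d > 0"
  proof (rule ccontr)
    assume "\<not> d > 0"
    with eq p(2) show False by (simp add: d_def)
  qed
  ultimately show ?thesis by (rule that[rotated])
qed

text \<open>The products \<open>x ^ i * y ^ j\<close> with exponents below the degrees of monic
  equations for \<open>x\<close> and \<open>y\<close> span a module stable under \<open>x\<close>
  and under \<open>y\<close>, hence under their sum and product.\<close>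

lemma algebraic_int_closed:
  fixes x y :: "'a :: field_char_0"
  assumes "algebraic_int x" "algebraic_int y"
  shows algebraic_int_add: "algebraic_int (x + y)"
    and algebraic_int_mult: "algebraic_int (x * y)"
proof -
  obtain d c where d: "d > 0" "x ^ d = (\<Sum>i<d. of_int (c i :: int) * x ^ i)"
    using algebraic_int_power_reduce[OF assms(1)] .
  obtain e c' where e: "e > 0" "y ^ e = (\<Sum>i<e. of_int (c' i :: int) * y ^ i)"
    using algebraic_int_power_reduce[OF assms(2)] .
  define V where "V = (\<lambda>(i, j). x ^ i * y ^ j) ` ({..<d} \<times> {..<e})"
  have V: "finite V" "1 \<in> V" using d e unfolding V_def by force+
  have base: "x ^ i * y ^ j \<in> zmod.span V" if "i < d" "j < e" for i j
    using that by (intro zmod.span_base) (auto simp: V_def)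
  have X: "x * v \<in> zmod.span V" if vV: "v \<in> V" for v
  proof -
    obtain i j where ij: "i < d" "j < e" "v = x ^ i * y ^ j" using vV by (auto simp: V_def)
    show ?thesis
    proof (cases "Suc i = d")
      case True
      have "x * v = x ^ d * y ^ j" unfolding ij(3) True[symmetric] by simp
      also have "\<dots> = (\<Sum>l<d. of_int (c l) * (x ^ l * y ^ j))"
        unfolding d(2) by (simp add: sum_distrib_right mult.assoc)
      also have "\<dots> \<in> zmod.span V"
        using base ij by (intro zmod.span_sum zmod.span_scale) auto
      finally show ?thesis .
    next
      case False
      with ij base[of "Suc i" j] show ?thesis by (simp add: mult.assoc)
    qed
  qed
  have Y: "y * v \<in> zmod.span V" if vV: "v \<in> V" for v
  proof -
    obtain i j where ij: "i < d" "j < e" "v = x ^ i * y ^ j" using vV by (auto simp: V_def)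
    show ?thesis
    proof (cases "Suc j = e")
      case True
      have "y * v = x ^ i * y ^ e" unfolding ij(3) True[symmetric] by simp
      also have "\<dots> = (\<Sum>l<e. of_int (c' l) * (x ^ i * y ^ l))"
        unfolding e(2) by (simp add: sum_distrib_left mult_ac)
      also have "\<dots> \<in> zmod.span V"
        using base ij by (intro zmod.span_sum zmod.span_scale) auto
      finally show ?thesis .
    next
      case False
      with ij base[of i "Suc j"] show ?thesis by (simp add: mult_ac)
    qed
  qed
  show "algebraic_int (x + y)"
    using V X Y by (intro algebraic_int_of_finite_module[of V 1])
      (simp_all add: ring_distribs zmod.span_add)
  show "algebraic_int (x * y)"
  proof (rule algebraic_int_of_finite_module[OF V])
    fix v assume "v \<in> V"
    thus "x * y * v \<in> zmod.span V"
      using zspan_mult_closed[OF X Y] by (simp add: mult.assoc)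
  qed simp
qed

lemma algebraic_int_of_int [simp, intro]: "algebraic_int (of_int c :: 'a :: field_char_0)"
  by (rule int_imp_algebraic_int) simp

lemma algebraic_int_power:
  fixes x :: "'a :: field_char_0"
  shows "algebraic_int x \<Longrightarrow> algebraic_int (x ^ i)"
  by (induction i) (auto intro: algebraic_int_mult int_imp_algebraic_int)

lemma algebraic_int_sum:
  fixes f :: "'b \<Rightarrow> 'a :: field_char_0"
  shows "(\<And>i. i \<in> A \<Longrightarrow> algebraic_int (f i)) \<Longrightarrow> algebraic_int (sum f A)"
  by (induction A rule: infinite_finite_induct) (auto intro: algebraic_int_add)

lemma algebraic_int_root_of_unity:
  fixes w :: "'a :: field_char_0"
  assumes "w ^ N = 1" "N > 0"
  shows "algebraic_int w"
proof (rule algebraic_int_root)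
  show "algebraic_int (1 :: 'a)" by (rule int_imp_algebraic_int) simp
  show "poly (monom 1 N) w = 1" using assms by (simp add: poly_monom)
  show "\<forall>i. coeff (monom 1 N :: 'a poly) i \<in> \<int>" by simp
  show "lead_coeff (monom 1 N :: 'a poly) = 1" by (simp add: degree_monom_eq)
  show "degree (monom 1 N :: 'a poly) > 0" using assms by (simp add: degree_monom_eq)
qed

text \<open>An integer polynomial of least degree vanishing at \<open>x\<close> has nonzero constant
  term. Its other terms are \<open>x\<close> times an integer polynomial in \<open>x\<close>, and
  the latter is integral whatever the leading coefficient.\<close>

lemma algebraic_int_divides_int:
  fixes x :: "'a :: field_char_0"
  assumes "algebraic_int x" "x \<noteq> 0"
  obtains y and c :: int where "algebraic_int y" "c \<noteq> 0" "y * x = of_int c"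
proof -
  define P where "P = (\<lambda>d. \<exists>p :: int poly. degree p = d \<and> p \<noteq> 0 \<and> poly (map_poly of_int p) x = 0)"
  have "\<exists>d. P d" using assms(1) unfolding P_def algebraic_int_altdef_ipoly
    by (metis leading_coeff_0_iff zero_neq_one)
  then obtain d where d: "P d" and min: "\<And>d'. d' < d \<Longrightarrow> \<not> P d'"
    by (metis exists_least_iff)
  obtain p where p: "degree p = d" "p \<noteq> 0" "poly (map_poly of_int p) x = 0"
    using d by (auto simp: P_def)
  obtain a q where pq: "p = pCons a q" by (cases p) auto
  have eq: "of_int a + x * poly (map_poly of_int q) x = 0"
    using p(2,3) by (simp add: pq map_poly_pCons)
  have "a \<noteq> 0"
  proof
    assume "a = 0"
    with eq assms(2) have "poly (map_poly of_int q) x = 0" by simp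
    moreover have "q \<noteq> 0" using p(2) \<open>a = 0\<close> by (auto simp: pq)
    moreover have "degree q < d" using \<open>q \<noteq> 0\<close> p(1) by (simp add: pq)
    ultimately show False using min unfolding P_def by blast
  qed
  moreover have "algebraic_int (- poly (map_poly of_int q) x)"
    using assms(1)
    by (auto simp: poly_altdef coeff_map_poly intro!: algebraic_int_sum algebraic_int_mult algebraic_int_power)
  moreover have "(- poly (map_poly of_int q) x) * x = of_int a"
    using eq by (simp add: add_eq_0_iff2 mult.commute)
  ultimately show ?thesis using that by blast
qed

section \<open>Cyclotomic fields\<close>

text \<open>Rational polynomials name the elements of the cyclotomic field: the value at
  \<open>\<zeta>\<close> is the element itself, the value at another root of the minimal polynomial
  is a conjugate.\<close>

definition reval :: "rat poly \<Rightarrow> complex \<Rightarrow> complex" where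
  "reval P z = poly (map_poly of_rat P) z"

lemma reval_0 [simp]: "reval 0 z = 0"
  and reval_pCons [simp]: "reval (pCons a P) z = of_rat a + z * reval P z"
  and reval_1 [simp]: "reval 1 z = 1"
  by (cases "a = 0 \<and> P = 0"; auto simp: reval_def map_poly_pCons)+

lemma reval_add [simp]: "reval (P + Q) z = reval P z + reval Q z"
  by (induction P Q rule: poly_induct2) (simp_all add: of_rat_add algebra_simps)

lemma reval_smult [simp]: "reval (smult c P) z = of_rat c * reval P z"
  by (induction P) (simp_all add: of_rat_mult algebra_simps)

lemma reval_mult [simp]: "reval (P * Q) z = reval P z * reval Q z"
  by (induction P) (simp_all add: algebra_simps)

lemma reval_minus [simp]: "reval (- P) z = - reval P z"
  using reval_smult[of "-1" P z] by simp

lemma reval_diff [simp]: "reval (P - Q) z = reval P z - reval Q z"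
  using reval_add[of P "-Q" z] by simp

lemma reval_power [simp]: "reval (P ^ i) z = reval P z ^ i"
  by (induction i) simp_all

lemma reval_monom [simp]: "reval (monom c i) z = of_rat c * z ^ i"
  by (simp add: reval_def map_poly_monom poly_monom)

lemma reval_pcompose [simp]: "reval (pcompose P Q) z = reval P (reval Q z)"
  by (induction P) (simp_all add: pcompose_pCons)

lemma reval_cnj: "reval P (cnj z) = cnj (reval P z)"
proof (induction P)
  case (pCons a P)
  have "cnj (of_rat a) = of_rat a"
    by (cases a) (simp add: of_rat_rat)
  with pCons show ?case by simp
qed simp

lemma reval_altdef: "reval P z = (\<Sum>i\<le>degree P. of_rat (coeff P i) * z ^ i)"
  by (simp add: reval_def poly_altdef coeff_map_poly degree_map_poly)


section \<open>The field, minimal polynomial and conjugates of a root of unity\<close>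

locale cyclotomic =
  fixes N :: nat and \<zeta> :: complex
  assumes prim: "primitive_root_of_unity N \<zeta>"
begin

lemma N_pos: "N > 0" and zeta_pow_N [simp]: "\<zeta> ^ N = 1"
  and zeta_pow_neq: "0 < i \<Longrightarrow> i < N \<Longrightarrow> \<zeta> ^ i \<noteq> 1"
  using prim by (auto simp: primitive_root_of_unity_def)

lemma zeta_nz [simp]: "\<zeta> \<noteq> 0"
  using zeta_pow_N N_pos by (metis zero_neq_one power_0_left less_numeral_extra(3))

lemma roots_eq_powers: "{w :: complex. w ^ N = 1} = (\<lambda>i. \<zeta> ^ i) ` {..<N}"
  and inj_powers: "inj_on (\<lambda>i. \<zeta> ^ i) {..<N}"
proof -
  show inj: "inj_on (\<lambda>i. \<zeta> ^ i) {..<N}"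
  proof (rule linorder_inj_onI')
    fix i j assume ij: "i \<in> {..<N}" "j \<in> {..<N}" "i < j"
    show "\<zeta> ^ i \<noteq> \<zeta> ^ j"
    proof
      assume eq: "\<zeta> ^ i = \<zeta> ^ j"
      have "\<zeta> ^ j = \<zeta> ^ i * \<zeta> ^ (j - i)" using ij by (simp flip: power_add)
      with eq have "\<zeta> ^ (j - i) = 1" by simp
      with zeta_pow_neq[of "j - i"] ij less_imp_diff_less[of j N i] show False by auto
    qed
  qed
  have "(\<lambda>i. \<zeta> ^ i) ` {..<N} \<subseteq> {w. w ^ N = 1}"
  proof clarify
    fix i
    have "(\<zeta> ^ i) ^ N = (\<zeta> ^ N) ^ i" by (simp only: mult.commute flip: power_mult)
    thus "(\<zeta> ^ i) ^ N = 1" by simp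
  qed
  moreover have "card ((\<lambda>i. \<zeta> ^ i) ` {..<N}) = card {w :: complex. w ^ N = 1}"
    using card_image[OF inj] card_roots_unity_eq[OF N_pos] by simp
  ultimately show "{w :: complex. w ^ N = 1} = (\<lambda>i. \<zeta> ^ i) ` {..<N}"
    using N_pos by (intro card_subset_eq[symmetric] finite_roots_unity) auto
qed

definition K :: "complex set" where "K = range (\<lambda>P. reval P \<zeta>)"

text \<open>A minimal polynomial of \<open>\<zeta>\<close>, determined only up to a rational
  factor.\<close>

definition Phi :: "rat poly" where
  "Phi = (ARG_MIN degree P. P \<noteq> 0 \<and> reval P \<zeta> = 0)"

lemma Phi: "Phi \<noteq> 0" "reval Phi \<zeta> = 0"
  and Phi_min: "reval P \<zeta> = 0 \<Longrightarrow> degree P < degree Phi \<Longrightarrow> P = 0"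
proof -
  let ?A = "\<lambda>P. P \<noteq> 0 \<and> reval P \<zeta> = 0"
  have "degree (monom 1 N - 1 :: rat poly) = N"
    using N_pos degree_add_eq_left[of "- 1" "monom 1 N :: rat poly"] by (simp add: degree_monom_eq)
  hence ex: "?A (monom 1 N - 1)" using N_pos by auto
  show "Phi \<noteq> 0" "reval Phi \<zeta> = 0"
    using arg_min_natI[of ?A, OF ex, of degree] unfolding Phi_def by auto
  show "reval P \<zeta> = 0 \<Longrightarrow> degree P < degree Phi \<Longrightarrow> P = 0"
    using arg_min_nat_le[of ?A P degree] unfolding Phi_def by auto
qed

lemma Phi_dvd: "reval P \<zeta> = 0 \<Longrightarrow> Phi dvd P"
proof -
  assume P: "reval P \<zeta> = 0"
  have "reval P \<zeta> = reval (P div Phi * Phi + P mod Phi) \<zeta>" by simp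
  with P Phi have "reval (P mod Phi) \<zeta> = 0" unfolding reval_add reval_mult by simp
  hence "P mod Phi = 0"
    using Phi_min degree_mod_less[OF Phi(1), of P] by blast
  thus ?thesis by (simp add: mod_eq_0_iff_dvd)
qed

definition R :: "complex set" where "R = {w. reval Phi w = 0}"

lemma zeta_R: "\<zeta> \<in> R" by (simp add: R_def Phi)

text \<open>\<open>Phi\<close> divides \<open>P - Q\<close>. This makes the substitution of
  \<open>w\<close> for \<open>\<zeta>\<close> well defined on \<open>K\<close>.\<close>

lemma R_transfer: "w \<in> R \<Longrightarrow> reval P \<zeta> = reval Q \<zeta> \<Longrightarrow> reval P w = reval Q w"
proof -
  assume w: "w \<in> R" and "reval P \<zeta> = reval Q \<zeta>"
  hence "Phi dvd P - Q" by (intro Phi_dvd) simp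
  then obtain S where "P - Q = Phi * S" by (elim dvdE)
  hence "reval (P - Q) w = 0" using w by (simp add: R_def)
  thus ?thesis by simp
qed

lemma R_unity: "w \<in> R \<Longrightarrow> w ^ N = 1"
  using R_transfer[of w "monom 1 N" 1] by simp

lemma R_nz: "w \<in> R \<Longrightarrow> w \<noteq> 0"
  using R_unity[of w] N_pos by (auto simp: zero_power)

lemma finite_R: "finite R"
  using R_unity N_pos by (intro finite_subset[OF _ finite_roots_unity[of N]]) auto

lemma K_reval [intro, simp]: "reval P \<zeta> \<in> K" by (simp add: K_def)

lemma K_cases: "x \<in> K \<Longrightarrow> (\<And>P. x = reval P \<zeta> \<Longrightarrow> thesis) \<Longrightarrow> thesis"
  by (auto simp: K_def)

lemma K_add [intro]: "x \<in> K \<Longrightarrow> y \<in> K \<Longrightarrow> x + y \<in> K"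
  and K_mult [intro]: "x \<in> K \<Longrightarrow> y \<in> K \<Longrightarrow> x * y \<in> K"
  and K_minus [intro]: "x \<in> K \<Longrightarrow> - x \<in> K"
  and K_diff [intro]: "x \<in> K \<Longrightarrow> y \<in> K \<Longrightarrow> x - y \<in> K"
  and K_power [intro]: "x \<in> K \<Longrightarrow> x ^ i \<in> K"
  and K_of_rat [simp, intro]: "of_rat c \<in> K"
  and K_zeta [simp, intro]: "\<zeta> \<in> K"
proof -
  show "x \<in> K \<Longrightarrow> y \<in> K \<Longrightarrow> x + y \<in> K" by (metis K_cases K_reval reval_add)
  show "x \<in> K \<Longrightarrow> y \<in> K \<Longrightarrow> x * y \<in> K" by (metis K_cases K_reval reval_mult)
  show "x \<in> K \<Longrightarrow> - x \<in> K" by (metis K_cases K_reval reval_minus)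
  show "x \<in> K \<Longrightarrow> y \<in> K \<Longrightarrow> x - y \<in> K" by (metis K_cases K_reval reval_diff)
  show "x \<in> K \<Longrightarrow> x ^ i \<in> K" by (metis K_cases K_reval reval_power)
  show "of_rat c \<in> K" using K_reval[of "[:c:]"] by simp
  show "\<zeta> \<in> K" using K_reval[of "[:0, 1:]"] by simp
qed

lemma K_Rats: "x \<in> \<rat> \<Longrightarrow> x \<in> K"
  by (auto elim!: Rats_cases)

lemma K_of_int [simp, intro]: "of_int c \<in> K" and K_numeral [simp, intro]: "numeral n \<in> K"
  and K_0 [simp, intro]: "0 \<in> K" and K_1 [simp, intro]: "1 \<in> K"
  by (simp_all add: K_Rats)

text \<open>Bezout: by minimality \<open>Phi\<close> is coprime to every polynomial that does not
  vanish at \<open>\<zeta>\<close>. This makes \<open>K\<close> a field.\<close>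

lemma reval_inverse_ex:
  assumes "reval P \<zeta> \<noteq> 0"
  obtains Q where "reval Q \<zeta> * reval P \<zeta> = 1"
proof -
  define g where "g = gcd P Phi"
  have nz: "reval g \<zeta> \<noteq> 0"
    using assms unfolding g_def by (metis dvdE gcd_dvd1 mult_zero_left reval_mult)
  obtain h where h: "Phi = g * h" unfolding g_def by (metis dvdE gcd_dvd2)
  \<comment> \<open>The cofactor \<open>h\<close> inherits the zero at \<open>\<zeta>\<close>, so it
    has full degree and the gcd is constant.\<close>
  have "reval h \<zeta> = 0" using Phi(2) nz unfolding h by simp
  moreover have "h \<noteq> 0" "g \<noteq> 0" using Phi(1) h by auto
  ultimately have "degree Phi \<le> degree h" using Phi_min by fastforce
  hence "degree g = 0" using \<open>h \<noteq> 0\<close> \<open>g \<noteq> 0\<close> by (simp add: h degree_mult_eq)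
  then obtain c where c: "g = [:c:]" by (rule degree_eq_zeroE)
  with \<open>g \<noteq> 0\<close> have "c \<noteq> 0" by simp
  obtain A B where "A * P + B * Phi = g"
    using bezout_coefficients_fst_snd[of P Phi] unfolding g_def by metis
  hence "reval A \<zeta> * reval P \<zeta> = of_rat c"
    using Phi(2) c by (metis add.right_neutral mult_zero_right reval_0 reval_add reval_mult reval_pCons)
  hence "reval (smult (inverse c) A) \<zeta> * reval P \<zeta> = of_rat (inverse c) * of_rat c"
    by simp
  also have "\<dots> = 1" using \<open>c \<noteq> 0\<close> by (simp flip: of_rat_mult)
  finally show ?thesis by (rule that)
qed

lemma K_inverse [intro]: "x \<in> K \<Longrightarrow> inverse x \<in> K"
proof (cases "x = 0")
  case False
  assume "x \<in> K"
  then obtain P where P: "x = reval P \<zeta>" by (rule K_cases)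
  then obtain Q where "reval Q \<zeta> * x = 1" using reval_inverse_ex False by metis
  hence "inverse x = reval Q \<zeta>" using False by (metis inverse_unique mult.commute)
  thus ?thesis by simp
qed simp

lemma K_divide [intro]: "x \<in> K \<Longrightarrow> y \<in> K \<Longrightarrow> x / y \<in> K"
  unfolding divide_inverse by blast

lemma K_prod [intro]: "(\<And>i. i \<in> A \<Longrightarrow> f i \<in> K) \<Longrightarrow> prod f A \<in> K"
  by (induction A rule: infinite_finite_induct) auto

lemma root_of_unity_K: "w ^ N = 1 \<Longrightarrow> w \<in> K"
proof -
  assume "w ^ N = 1"
  hence "w \<in> (\<lambda>i. \<zeta> ^ i) ` {..<N}" unfolding roots_eq_powers[symmetric] by simp
  thus "w \<in> K" by (metis K_power K_zeta imageE)
qed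

text \<open>A root of unity has modulus one, so conjugation inverts it. The natural exponent
  presents complex conjugation on \<open>K\<close> as substitution of a monomial.\<close>

lemma cnj_zeta: "cnj \<zeta> = \<zeta> ^ (N - 1)"
proof -
  have "cmod \<zeta> = cmod 1" by (rule power_eq_imp_eq_norm[of _ N]) (simp_all add: N_pos)
  hence "\<zeta> * cnj \<zeta> = 1" by (simp add: complex_norm_square[symmetric])
  also have "\<dots> = \<zeta> * \<zeta> ^ (N - 1)" using N_pos by (metis power_eq_if zeta_pow_N not_gr_zero)
  finally show ?thesis by simp
qed

lemma K_cnj [intro]: "x \<in> K \<Longrightarrow> cnj x \<in> K"
proof -
  assume "x \<in> K"
  then obtain P where "x = reval P \<zeta>" by (rule K_cases)
  hence "cnj x = reval (pcompose P (monom 1 (N - 1))) \<zeta>" unfolding reval_pcompose reval_monom by (simp add: reval_cnj[symmetric] cnj_zeta)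
  thus ?thesis by (metis K_reval)
qed

end

section \<open>Embeddings and traces\<close>

context cyclotomic begin

text \<open>The embedding of \<open>K\<close> that sends \<open>\<zeta>\<close> to \<open>w\<close>.
  For \<open>w\<close> in \<open>R\<close> the choice of polynomial does not matter, by
  \<open>R_transfer\<close>.\<close>

definition emb :: "complex \<Rightarrow> complex \<Rightarrow> complex" where
  "emb w y = reval (SOME P. reval P \<zeta> = y) w"

lemma emb_reval: "w \<in> R \<Longrightarrow> emb w (reval P \<zeta>) = reval P w"
  unfolding emb_def by (rule R_transfer, assumption, rule someI[of _ P], rule refl)

lemma emb_zeta: "y \<in> K \<Longrightarrow> emb \<zeta> y = y"
  by (metis K_cases emb_reval zeta_R)

lemma emb_diff: "w \<in> R \<Longrightarrow> x \<in> K \<Longrightarrow> y \<in> K \<Longrightarrow> emb w (x - y) = emb w x - emb w y"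
  by (metis K_cases emb_reval reval_diff)

lemma emb_mult: "w \<in> R \<Longrightarrow> x \<in> K \<Longrightarrow> y \<in> K \<Longrightarrow> emb w (x * y) = emb w x * emb w y"
  by (metis K_cases emb_reval reval_mult)

lemma emb_power: "w \<in> R \<Longrightarrow> x \<in> K \<Longrightarrow> emb w (x ^ i) = emb w x ^ i"
  by (metis K_cases emb_reval reval_power)

lemma emb_Rats: "w \<in> R \<Longrightarrow> x \<in> \<rat> \<Longrightarrow> emb w x = x"
proof -
  assume w: "w \<in> R" and "x \<in> \<rat>"
  then obtain c where "x = of_rat c" by (elim Rats_cases)
  thus ?thesis using emb_reval[OF w, of "[:c:]"] by simp
qed

lemma emb_of_int [simp]: "w \<in> R \<Longrightarrow> emb w (of_int c) = of_int c"
  and emb_numeral [simp]: "w \<in> R \<Longrightarrow> emb w (numeral n) = numeral n"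
  and emb_0 [simp]: "w \<in> R \<Longrightarrow> emb w 0 = 0"
  and emb_1 [simp]: "w \<in> R \<Longrightarrow> emb w 1 = 1"
  by (simp_all add: emb_Rats)

lemma emb_inj: "w \<in> R \<Longrightarrow> x \<in> K \<Longrightarrow> y \<in> K \<Longrightarrow> emb w x = emb w y \<longleftrightarrow> x = y"
proof
  assume w: "w \<in> R" and x: "x \<in> K" and y: "y \<in> K" and eq: "emb w x = emb w y"
  show "x = y"
  proof (rule ccontr)
    assume "x \<noteq> y"
    hence "(x - y) * inverse (x - y) = 1" by simp
    moreover have "emb w ((x - y) * inverse (x - y)) = emb w (x - y) * emb w (inverse (x - y))"
      using w x y by (intro emb_mult) auto
    moreover have "emb w (x - y) = 0" using w x y eq by (simp add: emb_diff)
    ultimately show False using w by simp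
  qed
qed simp

lemma R_power: "w \<in> R \<Longrightarrow> \<exists>i. w = \<zeta> ^ i"
  using R_unity[of w] roots_eq_powers by blast

text \<open>The Galois group is abelian: \<open>v\<close> and \<open>w\<close> are powers of
  \<open>\<zeta>\<close>, so both composites raise \<open>\<zeta>\<close> to the product of the two
  exponents.\<close>

lemma emb_commute:
  assumes "v \<in> R" "w \<in> R" "y \<in> K"
  shows "emb v (emb w y) = emb w (emb v y)"
proof -
  obtain P where P: "y = reval P \<zeta>" using assms(3) by (rule K_cases)
  obtain i where i: "v = \<zeta> ^ i" using R_power[OF assms(1)] by blast
  obtain j where j: "w = \<zeta> ^ j" using R_power[OF assms(2)] by blast
  have "emb v (reval P w) = emb v (reval (pcompose P (monom 1 j)) \<zeta>)"
    by (simp add: j)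
  also have "\<dots> = reval (pcompose P (monom 1 j)) v" using assms(1) by (rule emb_reval)
  also have "\<dots> = reval P ((\<zeta> ^ i) ^ j)" by (simp add: i)
  also have "(\<zeta> ^ i) ^ j = (\<zeta> ^ j) ^ i" by (simp only: mult.commute flip: power_mult)
  also have "reval P ((\<zeta> ^ j) ^ i) = reval (pcompose P (monom 1 i)) w" by (simp add: j)
  also have "\<dots> = emb w (reval (pcompose P (monom 1 i)) \<zeta>)" using assms(2) by (rule emb_reval[symmetric])
  also have "\<dots> = emb w (reval P v)" by (simp add: i)
  finally show ?thesis using assms by (simp add: P emb_reval)
qed

text \<open>Conjugation is the power map with exponent \<open>N - 1\<close> at
  \<open>\<zeta>\<close> and at the root of unity \<open>w\<close> alike.\<close>

lemma emb_cnj: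
  assumes "w \<in> R" "y \<in> K"
  shows "emb w (cnj y) = cnj (emb w y)"
proof -
  obtain P where P: "y = reval P \<zeta>" using assms(2) by (rule K_cases)
  have cw: "cnj w = w ^ (N - 1)"
  proof -
    obtain i where i: "w = \<zeta> ^ i" using R_power[OF assms(1)] by blast
    show ?thesis by (simp add: i cnj_zeta mult.commute flip: power_mult)
  qed
  have "emb w (cnj y) = emb w (reval (pcompose P (monom 1 (N - 1))) \<zeta>)"
    unfolding reval_pcompose reval_monom by (simp add: P reval_cnj[symmetric] cnj_zeta)
  also have "\<dots> = reval (pcompose P (monom 1 (N - 1))) w" using assms(1) by (rule emb_reval)
  also have "\<dots> = cnj (reval P w)" unfolding reval_pcompose reval_monom by (simp add: reval_cnj[symmetric] cw)
  finally show ?thesis using assms by (simp add: P emb_reval)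
qed

lemma algebraic_int_emb:
  assumes "w \<in> R" "y \<in> K" "algebraic_int y"
  shows "algebraic_int (emb w y)"
proof -
  obtain P where P: "y = reval P \<zeta>" using assms(2) by (rule K_cases)
  obtain p :: "int poly" where p: "poly (map_poly of_int p) y = 0" "lead_coeff p = 1"
    using assms(3) unfolding algebraic_int_altdef_ipoly by auto
  define q :: "rat poly" where "q = map_poly of_int p"
  have q: "reval q z = poly (map_poly of_int p) z" for z
    by (simp add: reval_def q_def map_poly_map_poly o_def)
  have "reval (pcompose q P) \<zeta> = reval 0 \<zeta>" using p(1) by (simp add: q P)
  hence "reval (pcompose q P) w = reval 0 w" using R_transfer assms(1) by blast
  hence "poly (map_poly of_int p) (emb w y) = 0" using assms(1) by (simp add: q P emb_reval)
  thus ?thesis using p(2) unfolding algebraic_int_altdef_ipoly by blast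
qed

section \<open>Traces, Kronecker's theorem and integrality\<close>

lemma sum_powers_root:
  assumes "w ^ N = 1"
  shows "(\<Sum>i<N. w ^ i) = (if w = 1 then of_nat N else (0 :: complex))"
  using assms by (simp add: geometric_sum)

text \<open>Each power sum over all \<open>N\<close>-th roots of unity is a geometric sum, equal to
  0 or \<open>N\<close>.\<close>

lemma sum_unity_Rats: "(\<Sum>w | w ^ N = 1. reval P w) \<in> \<rat>"
proof -
  have "(\<Sum>j<N. (\<zeta> ^ i) ^ j) \<in> \<rat>" for i
    by (subst sum_powers_root) (simp_all add: mult.commute flip: power_mult, simp_all add: power_mult)
  moreover have "(\<Sum>w | w ^ N = 1. w ^ i) = (\<Sum>j<N. (\<zeta> ^ i) ^ j)" for i
    unfolding roots_eq_powers by (subst sum.reindex[OF inj_powers])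
      (simp add: mult.commute flip: power_mult)
  moreover have "(\<Sum>w | w ^ N = 1. reval P w) =
      (\<Sum>i\<le>degree P. of_rat (coeff P i) * (\<Sum>w | w ^ N = 1. w ^ i))"
    unfolding reval_altdef sum_distrib_left by (rule sum.swap)
  ultimately show ?thesis by (simp add: Rats_sum)
qed

text \<open>
  A rational polynomial equal to 1 on \<^term>\<open>R\<close> and 0 at the other roots of unity turns a trace over
  \<^term>\<open>R\<close> into a sum over all of them.
\<close>

lemma R_idempotent:
  obtains e where "\<And>w. w \<in> R \<Longrightarrow> reval e w = 1" "\<And>w. w ^ N = 1 \<Longrightarrow> w \<notin> R \<Longrightarrow> reval e w = 0"
proof -
  define F :: "rat poly" where "F = monom 1 N - 1"
  have F: "reval F w = w ^ N - 1" for w by (simp add: F_def)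
  obtain h where h: "F = Phi * h" using Phi_dvd[of F] F by (auto elim!: dvdE)
  \<comment> \<open>\<open>F\<close> has no double root at \<open>\<zeta>\<close>: a second factor
    \<open>Phi\<close> would divide the derivative too, which does not vanish there.\<close>
  have "reval h \<zeta> \<noteq> 0"
  proof
    assume "reval h \<zeta> = 0"
    then obtain g where "h = Phi * g" using Phi_dvd by (auto elim!: dvdE)
    hence "F = Phi ^ 2 * g" using h by (simp add: power2_eq_square)
    hence "pderiv F = Phi * (2 * pderiv Phi * g + Phi * pderiv g)"
      by (simp add: pderiv_mult power2_eq_square algebra_simps)
    hence "reval (pderiv F) \<zeta> = 0" using Phi by simp
    moreover have "pderiv F = monom (of_nat N) (N - 1)" by (simp add: F_def pderiv_diff pderiv_monom)
    ultimately show False using N_pos by simp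
  qed
  \<comment> \<open>\<open>B * h\<close> is the desired polynomial: \<open>B\<close> inverts
    \<open>h\<close> on \<open>R\<close>, while \<open>h\<close> vanishes at the other roots of
    unity.\<close>
  then obtain B where B: "reval B \<zeta> * reval h \<zeta> = 1" by (rule reval_inverse_ex)
  show ?thesis
  proof (rule that)
    fix w assume "w \<in> R"
    thus "reval (B * h) w = 1" using R_transfer[of w "B * h" 1] B by simp
  next
    fix w assume "w ^ N = 1" "w \<notin> R"
    hence "reval Phi w * reval h w = 0" "reval Phi w \<noteq> 0"
      using F[of w] by (simp_all add: h R_def)
    thus "reval (B * h) w = 0" by simp
  qed
qed

lemma trace_Rats: "(\<Sum>w\<in>R. reval P w) \<in> \<rat>"
proof -
  obtain e where e: "\<And>w. w \<in> R \<Longrightarrow> reval e w = 1"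
    "\<And>w. w ^ N = 1 \<Longrightarrow> w \<notin> R \<Longrightarrow> reval e w = 0" by (rule R_idempotent) blast
  have "(\<Sum>w\<in>R. reval P w) = (\<Sum>w | w ^ N = 1. reval (P * e) w)"
    using e R_unity N_pos by (intro sum.mono_neutral_cong_left finite_roots_unity) auto
  thus ?thesis using sum_unity_Rats[of "P * e"] by simp
qed

text \<open>The trace of such a \<open>y\<close> is \<open>card R\<close> times \<open>y\<close>,
  and traces are rational.\<close>

lemma fixed_imp_Rats:
  assumes "y \<in> K" "\<And>w. w \<in> R \<Longrightarrow> emb w y = y"
  shows "y \<in> \<rat>"
proof -
  obtain P where P: "y = reval P \<zeta>" using assms(1) by (rule K_cases)
  have "(\<Sum>w\<in>R. reval P w) = (\<Sum>w\<in>R. y)"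
    using assms(2) by (intro sum.cong) (simp_all add: P emb_reval)
  hence "of_nat (card R) * y \<in> \<rat>" using trace_Rats[of P] by simp
  hence "of_nat (card R) * y / of_nat (card R) \<in> \<rat>" by (intro Rats_divide) auto
  moreover have "card R > 0" using zeta_R finite_R by (auto simp: card_gt_0_iff)
  ultimately show ?thesis by simp
qed

text \<open>The trace of \<open>y\<close> divided by the \<open>i\<close>-th power of
  \<open>\<zeta>\<close>: for \<open>i < N\<close> the exponent \<open>N - i\<close> stands for
  \<open>- i\<close>, since \<open>w ^ N = 1\<close>.\<close>

definition trace_coeff :: "nat \<Rightarrow> complex \<Rightarrow> complex" where
  "trace_coeff i y = (\<Sum>w\<in>R. emb w y * w ^ (N - i))"

text \<open>Fourier inversion: after exchanging the sums, the inner one is geometric in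
  \<open>\<zeta> / w\<close> and vanishes unless \<open>w = \<zeta>\<close>.\<close>

lemma trace_coeff_expansion:
  assumes "y \<in> K"
  shows "of_nat N * y = (\<Sum>i<N. trace_coeff i y * \<zeta> ^ i)"
proof -
  have "(\<Sum>i<N. trace_coeff i y * \<zeta> ^ i) = (\<Sum>w\<in>R. emb w y * (\<Sum>i<N. w ^ (N - i) * \<zeta> ^ i))"
    unfolding trace_coeff_def sum_distrib_right sum_distrib_left
    by (subst sum.swap) (simp add: mult.assoc)
  also have "\<dots> = (\<Sum>w\<in>R. if w = \<zeta> then of_nat N * y else 0)"
  proof (rule sum.cong)
    fix w assume w: "w \<in> R"
    have "w ^ (N - i) * \<zeta> ^ i = (\<zeta> / w) ^ i" if "i < N" for i
      using that w R_unity[OF w] R_nz[OF w] by (simp add: power_diff power_divide)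
    hence "(\<Sum>i<N. w ^ (N - i) * \<zeta> ^ i) = (\<Sum>i<N. (\<zeta> / w) ^ i)" by simp
    also have "\<dots> = (if \<zeta> / w = 1 then of_nat N else 0)"
      using R_unity[OF w] by (intro sum_powers_root) (simp add: power_divide)
    finally show "emb w y * (\<Sum>i<N. w ^ (N - i) * \<zeta> ^ i) = (if w = \<zeta> then of_nat N * y else 0)"
      using R_nz[OF w] assms by (auto simp: emb_zeta)
  qed simp
  also have "\<dots> = of_nat N * y" using zeta_R finite_R by simp
  finally show ?thesis by simp
qed

text \<open>The trace of an algebraic integer is rational and integral. Up to the factor
  \<open>N\<close>, algebraic integers of \<open>K\<close> thus have integer coordinates in the
  powers of \<open>\<zeta>\<close>.\<close>

lemma trace_coeff_Ints:
  assumes "y \<in> K" "algebraic_int y"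
  shows "trace_coeff i y \<in> \<int>"
proof (rule rational_algebraic_int_is_int)
  show "algebraic_int (trace_coeff i y)"
    unfolding trace_coeff_def using assms algebraic_int_emb R_unity N_pos
    by (auto intro!: algebraic_int_sum algebraic_int_mult algebraic_int_power
             intro: algebraic_int_root_of_unity)
  obtain P where P: "y = reval P \<zeta>" using assms(1) by (rule K_cases)
  have "trace_coeff i y = (\<Sum>w\<in>R. reval (P * monom 1 (N - i)) w)"
    unfolding trace_coeff_def by (simp add: P emb_reval)
  thus "trace_coeff i y \<in> \<rat>" using trace_Rats by metis
qed

lemma norm_trace_coeff_le:
  assumes "\<And>w. w \<in> R \<Longrightarrow> cmod (emb w y) \<le> 1"
  shows "cmod (trace_coeff i y) \<le> card R"
proof -
  have "cmod (trace_coeff i y) \<le> (\<Sum>w\<in>R. cmod (emb w y * w ^ (N - i)))"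
    unfolding trace_coeff_def by (rule norm_sum)
  also have "\<dots> \<le> (\<Sum>w\<in>R. 1)"
  proof (rule sum_mono)
    fix w assume w: "w \<in> R"
    have "cmod w = cmod 1" using R_unity[OF w] N_pos by (intro power_eq_imp_eq_norm[of _ N]) auto
    thus "cmod (emb w y * w ^ (N - i)) \<le> 1" using assms[OF w] by (simp add: norm_mult norm_power)
  qed
  finally show ?thesis by simp
qed

text \<open>
  Kronecker: the integers \<^term>\<open>trace_coeff i (y ^ j)\<close> are bounded, so two powers of \<open>y\<close> coincide.
\<close>

lemma bounded_conjugates_imp_root_of_unity:
  assumes y: "y \<in> K" "algebraic_int y" "y \<noteq> 0" and bnd: "\<And>w. w \<in> R \<Longrightarrow> cmod (emb w y) \<le> 1"
  obtains t where "t > 0" "y ^ t = 1"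
proof -
  define f where "f = (\<lambda>j. restrict (\<lambda>i. trace_coeff i (y ^ j)) {..<N})"
  define B :: "complex set" where "B = of_int ` {- int (card R)..int (card R)}"
  have "f j \<in> {..<N} \<rightarrow>\<^sub>E B" for j
  proof -
    have "trace_coeff i (y ^ j) \<in> B" for i
    proof -
      have "trace_coeff i (y ^ j) \<in> \<int>"
        using y by (intro trace_coeff_Ints algebraic_int_power) auto
      then obtain c where c: "trace_coeff i (y ^ j) = of_int c" by (elim Ints_cases)
      have "cmod (trace_coeff i (y ^ j)) \<le> card R"
        using bnd y(1) by (intro norm_trace_coeff_le) (simp add: emb_power norm_power power_le_one)
      hence "real_of_int \<bar>c\<bar> \<le> real_of_int (int (card R))" by (simp add: c)
      hence "\<bar>c\<bar> \<le> int (card R)" by (simp only: of_int_le_iff)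
      hence "c \<in> {- int (card R)..int (card R)}" by auto
      thus ?thesis by (simp add: c B_def)
    qed
    thus ?thesis by (auto simp: f_def)
  qed
  hence "finite (range f)"
    by (intro finite_subset[OF _ finite_PiE[of "{..<N}" "\<lambda>_. B"]]) (auto simp: B_def)
  hence "\<not> inj f" using finite_imageD infinite_UNIV_nat by blast
  then obtain a b where ab: "a < b" "f a = f b" by (metis linorder_injI)
  have "trace_coeff i (y ^ a) = trace_coeff i (y ^ b)" if "i < N" for i
    using fun_cong[OF ab(2), of i] that by (simp add: f_def)
  hence "of_nat N * y ^ a = of_nat N * y ^ b"
    using y(1) by (simp add: trace_coeff_expansion K_power)
  hence "y ^ a = y ^ b" using N_pos by simp
  moreover have "y ^ b = y ^ a * y ^ (b - a)" using ab(1) by (simp flip: power_add)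
  ultimately have "y ^ (b - a) = 1" using y(3) by simp
  thus ?thesis using ab(1) by (intro that[of "b - a"]) auto
qed

text \<open>Embeddings commute with conjugation, so every conjugate of \<open>v / cnj v\<close> has
  modulus one and Kronecker's theorem applies.\<close>

lemma unit_quotient_cnj_root_of_unity:
  assumes v: "v \<in> K" "algebraic_int v" "algebraic_int (inverse v)" "v \<noteq> 0"
  obtains t where "t > 0" "(v / cnj v) ^ t = 1"
proof (rule bounded_conjugates_imp_root_of_unity)
  show "v / cnj v \<in> K" using v(1) by blast
  have "cnj (inverse v) = inverse (cnj v)" by simp
  with v show "algebraic_int (v / cnj v)" unfolding divide_inverse
    by (metis algebraic_int_mult algebraic_int_cnj)
  show "v / cnj v \<noteq> 0" using v by simp
  fix w assume w: "w \<in> R"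
  have "v / cnj v * cnj v = v" using v by simp
  hence "emb w (v / cnj v) * cnj (emb w v) = emb w v"
    using emb_mult[OF w, of "v / cnj v" "cnj v"] v(1) w
    by (simp add: emb_cnj K_divide K_cnj)
  hence "cmod (emb w (v / cnj v)) * cmod (emb w v) = cmod (emb w v)"
    by (metis complex_mod_cnj norm_mult)
  moreover have "emb w v \<noteq> 0" using emb_inj[OF w v(1) K_0] v(4) w by simp
  ultimately show "cmod (emb w (v / cnj v)) \<le> 1" by simp
qed (rule that)

text \<open>
  By pigeonhole on the coefficients of a multiple of \<open>x ^ n\<close>, some difference \<open>x ^ b - x ^ a\<close> is an integer
  combination of powers of \<open>\<zeta>\<close>.
\<close>

lemma almost_integral_imp_algebraic_int:
  assumes x: "x \<in> K" and d: "algebraic_int d" "d \<noteq> 0"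
    and int: "\<And>n. algebraic_int (d * x ^ n)"
  shows "algebraic_int x"
proof -
  obtain d' and c :: int where c: "algebraic_int d'" "c \<noteq> 0" "d' * d = of_int c"
    using d by (rule algebraic_int_divides_int)
  have int': "algebraic_int (of_int c * x ^ n)" for n
    using algebraic_int_mult[OF c(1) int[of n]] unfolding mult.assoc[symmetric] c(3) .
  have "trace_coeff i (of_int c * x ^ n) \<in> \<int>" for i n
    using x int' by (intro trace_coeff_Ints) auto
  hence "\<forall>n i. \<exists>a. trace_coeff i (of_int c * x ^ n) = of_int a" by (meson Ints_cases)
  then obtain A :: "nat \<Rightarrow> nat \<Rightarrow> int"
    where A: "\<And>n i. trace_coeff i (of_int c * x ^ n) = of_int (A n i)" by metis
  \<comment> \<open>The modulus absorbs both the factor \<open>N\<close> of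
    \<open>trace_coeff_expansion\<close> and the denominator \<open>c\<close>.\<close>
  define M where "M = int N * \<bar>c\<bar>"
  have M: "M > 0" using N_pos c(2) by (simp add: M_def)
  define f where "f = (\<lambda>n. restrict (\<lambda>i. A n i mod M) {..<N})"
  have "finite (range f)"
    using M by (intro finite_subset[OF _ finite_PiE[of "{..<N}" "\<lambda>_. {0..M}"]]) (auto simp: f_def less_imp_le)
  hence "\<not> inj f" using finite_imageD infinite_UNIV_nat by blast
  then obtain a b where ab: "a < b" "f a = f b" by (metis linorder_injI)
  have "\<exists>k. A b i - A a i = of_nat N * c * k" if "i < N" for i
  proof -
    have "A a i mod M = A b i mod M" using fun_cong[OF ab(2), of i] that by (simp add: f_def)
    hence "M dvd A b i - A a i" by (metis mod_eq_dvd_iff)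
    hence "of_nat N * c dvd A b i - A a i"
      unfolding M_def by (metis abs_dvd_iff abs_mult abs_of_nat)
    thus ?thesis by (auto elim!: dvdE)
  qed
  then obtain k where k: "\<And>i. i < N \<Longrightarrow> A b i - A a i = of_nat N * c * k i" by metis
  have "of_nat N * of_int c * (x ^ b - x ^ a) =
      of_nat N * (of_int c * x ^ b) - of_nat N * (of_int c * x ^ a)" by (simp add: algebra_simps)
  also have "\<dots> = (\<Sum>i<N. of_int (A b i - A a i) * \<zeta> ^ i)"
    using x by (subst (1 2) trace_coeff_expansion) (auto simp: A sum_subtractf algebra_simps)
  also have "\<dots> = (\<Sum>i<N. of_nat N * of_int c * (of_int (k i) * \<zeta> ^ i))"
    by (intro sum.cong) (simp_all add: k)
  also have "\<dots> = of_nat N * of_int c * (\<Sum>i<N. of_int (k i) * \<zeta> ^ i)"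
    by (simp add: sum_distrib_left)
  finally have eq: "x ^ b - x ^ a = (\<Sum>i<N. of_int (k i) * \<zeta> ^ i)" using N_pos c(2) by simp
  have "algebraic_int (x ^ b - x ^ a)" unfolding eq
    using algebraic_int_root_of_unity[OF zeta_pow_N N_pos]
    by (intro algebraic_int_sum algebraic_int_mult algebraic_int_power) auto
  \<comment> \<open>A monic polynomial of positive degree takes an integral value at
    \<open>x\<close>, so \<open>x\<close> is integral.\<close>
  moreover have deg: "degree (monom 1 b - monom 1 a :: complex poly) = b"
    using ab(1) degree_add_eq_left[of "- monom 1 a" "monom 1 b :: complex poly"]
    by (simp add: degree_monom_eq)
  moreover have "coeff (monom 1 b - monom 1 a :: complex poly) b = 1" using ab(1) by simp
  ultimately show ?thesis
    using ab(1) by - (rule algebraic_int_root[of "x ^ b - x ^ a" "monom 1 b - monom 1 a"];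
      simp add: poly_monom)
qed

end

section \<open>Square roots and cubic elements in cyclotomic fields\<close>

text \<open>The sum \<open>A\<close> of the powers of X below \<open>n\<close> and the product
  \<open>B\<close> of the linear factors are monic of degree \<open>n - 1\<close> and share
  \<open>n - 1\<close> distinct roots. Hence they agree, and the claim is their value at 1.\<close>

lemma prod_one_minus_roots_of_unity:
  assumes "primitive_root_of_unity n \<eta>"
  shows "(\<Prod>j\<in>{1..<n}. 1 - \<eta> ^ j) = of_nat n"
proof -
  interpret cyclotomic n \<eta> by unfold_locales (rule assms)
  define A :: "complex poly" where "A = (\<Sum>i<n. monom 1 i)"
  define B :: "complex poly" where "B = (\<Prod>j\<in>{1..<n}. [:- (\<eta> ^ j), 1:])"
  have "A = B"
  proof (rule ccontr)
    assume "A \<noteq> B"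
    have cA: "coeff A i = (if i < n then 1 else 0)" for i
      by (simp add: A_def coeff_sum)
    have dB: "degree B = n - 1"
      unfolding B_def by (subst degree_prod_eq_sum_degree) auto
    have lB: "lead_coeff B = 1" unfolding B_def by (rule monic_prod) auto
    have zero: "coeff (A - B) i = 0" if "i \<ge> n - 1" for i
    proof (cases "i = n - 1")
      case True
      thus ?thesis using lB N_pos unfolding dB by (simp add: cA)
    next
      case False
      with that have "i \<ge> n" "i > degree B" by (auto simp: dB)
      thus ?thesis by (simp add: cA coeff_eq_0)
    qed
    have "degree (A - B) < n - 1"
    proof (rule ccontr)
      assume "\<not> degree (A - B) < n - 1"
      hence "lead_coeff (A - B) = 0" by (intro zero) simp
      thus False using \<open>A \<noteq> B\<close> unfolding leading_coeff_0_iff by simp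
    qed
    moreover have "n - 1 \<le> card {z. poly (A - B) z = 0}"
    proof -
      have "poly (A - B) (\<eta> ^ j) = 0" if j: "j \<in> {1..<n}" for j
      proof -
        have "poly B (\<eta> ^ j) = 0" using j by (auto simp: B_def poly_prod)
        moreover have "poly A (\<eta> ^ j) = (\<Sum>i<n. (\<eta> ^ j) ^ i)"
          by (simp add: A_def poly_sum poly_monom)
        moreover have "(\<eta> ^ j) ^ n = (\<eta> ^ n) ^ j" by (simp only: mult.commute flip: power_mult)
        ultimately show ?thesis using zeta_pow_neq[of j] j by (simp add: sum_powers_root)
      qed
      hence "(\<lambda>j. \<eta> ^ j) ` {1..<n} \<subseteq> {z. poly (A - B) z = 0}" by auto
      moreover have "card ((\<lambda>j. \<eta> ^ j) ` {1..<n}) = n - 1"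
        by (subst card_image[OF inj_on_subset[OF inj_powers]]) auto
      moreover have "finite {z. poly (A - B) z = 0}"
        using \<open>A \<noteq> B\<close> by (intro poly_roots_finite) simp
      ultimately show ?thesis by (metis card_mono)
    qed
    moreover have "card {z. poly (A - B) z = 0} \<le> degree (A - B)"
      using \<open>A \<noteq> B\<close> by (intro card_poly_roots_bound) simp
    ultimately show False by simp
  qed
  hence "poly A 1 = poly B 1" by simp
  thus ?thesis by (simp add: A_def B_def poly_sum poly_prod poly_monom)
qed

context cyclotomic begin

lemma imaginary_unit_K: "4 dvd N \<Longrightarrow> \<i> \<in> K"
  by (rule root_of_unity_K) (auto elim!: dvdE simp: power_mult)

lemma primitive_root_power:
  assumes "n dvd N"
  shows "primitive_root_of_unity n (\<zeta> ^ (N div n))"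
proof -
  have n: "n > 0" using assms N_pos by (auto intro: dvd_pos_nat)
  have "(\<zeta> ^ (N div n)) ^ i \<noteq> 1" if i: "0 < i" "i < n" for i
  proof -
    have q: "N div n > 0" using assms N_pos by (metis dvd_div_eq_0_iff neq0_conv)
    have "N div n * i < N div n * n" using i q by (metis mult_less_mono2)
    hence "N div n * i < N" using assms by simp
    moreover have "N div n * i > 0" using q i by simp
    ultimately show ?thesis unfolding power_mult[symmetric] by (intro zeta_pow_neq)
  qed
  moreover have "(\<zeta> ^ (N div n)) ^ n = 1" using assms by (simp flip: power_mult)
  ultimately show ?thesis using n by (simp add: primitive_root_of_unity_def)
qed

text \<open>
  In \<open>n = (\<Prod>j\<in>{1..<n}. 1 - \<eta> ^ j)\<close> the factors for \<open>j\<close> and \<open>n - j\<close> multiply to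
  \<open>(\<i> * (\<theta> ^ j - inverse \<theta> ^ j))\<^sup>2\<close>, where \<open>\<eta> = \<theta>\<^sup>2\<close>.
\<close>

lemma sqrt_neg_odd_K:
  assumes "odd n" "4 * n dvd N"
  obtains x where "x \<in> K" "x ^ 2 = - of_nat n"
proof -
  obtain h where h: "n = 2 * h + 1" using assms(1) by (elim oddE)
  have "n dvd N" "4 dvd N" using assms(2) by (auto intro: dvd_mult_right dvd_mult_left)
  define \<eta> where "\<eta> = \<zeta> ^ (N div n)"
  have prim': "primitive_root_of_unity n \<eta>"
    unfolding \<eta>_def using \<open>n dvd N\<close> by (rule primitive_root_power)
  hence \<eta>: "\<eta> ^ n = 1" "\<eta> \<noteq> 0" by (auto simp: primitive_root_of_unity_def \<eta>_def)
  \<comment> \<open>A square root of \<open>\<eta>\<close> among its own powers: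
    \<open>2 * (h + 1) = n + 1\<close> and \<open>\<eta> ^ n = 1\<close>.\<close>
  define \<theta> where "\<theta> = \<eta> ^ (h + 1)"
  have "\<theta> ^ 2 = \<eta> ^ n * \<eta>" unfolding \<theta>_def power2_eq_square power_add[symmetric] power_Suc2[symmetric] by (simp add: h mult_2)
  hence \<theta>: "\<theta> ^ 2 = \<eta>" "\<theta> \<noteq> 0" using \<eta> by (simp_all add: \<theta>_def)
  define W where "W = (\<Prod>j\<in>{1..h}. \<i> * (\<theta> ^ j - inverse \<theta> ^ j))"
  have "of_nat n = (\<Prod>j\<in>{1..<n}. 1 - \<eta> ^ j)"
    using prod_one_minus_roots_of_unity[OF prim'] by simp
  also have "{1..<n} = {1..h} \<union> {h+1..2*h}" by (auto simp: h)
  also have "(\<Prod>j\<in>{1..h} \<union> {h+1..2*h}. 1 - \<eta> ^ j) =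
      (\<Prod>j\<in>{1..h}. 1 - \<eta> ^ j) * (\<Prod>j\<in>{h+1..2*h}. 1 - \<eta> ^ j)"
    by (rule prod.union_disjoint) auto
  also have "(\<Prod>j\<in>{h+1..2*h}. 1 - \<eta> ^ j) = (\<Prod>j\<in>{1..h}. 1 - \<eta> ^ (n - j))"
    by (rule prod.reindex_bij_witness[of _ "\<lambda>j. n - j" "\<lambda>j. n - j"]) (auto simp: h)
  also have "(\<Prod>j\<in>{1..h}. 1 - \<eta> ^ j) * (\<Prod>j\<in>{1..h}. 1 - \<eta> ^ (n - j)) =
      (\<Prod>j\<in>{1..h}. (\<i> * (\<theta> ^ j - inverse \<theta> ^ j)) ^ 2)"
    unfolding prod.distrib[symmetric]
  proof (rule prod.cong)
    fix j assume j: "j \<in> {1..h}"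
    define t where "t = \<theta> ^ j"
    have t: "t \<noteq> 0" using \<theta> by (simp add: t_def)
    have 1: "\<eta> ^ j = t ^ 2" unfolding \<theta>(1)[symmetric] t_def by (simp add: mult.commute flip: power_mult)
    have 2: "\<eta> ^ (n - j) = inverse (t ^ 2)"
      using j \<eta> h by (simp add: power_diff 1 divide_inverse)
    have 3: "inverse \<theta> ^ j = inverse t" by (simp add: t_def power_inverse)
    show "(1 - \<eta> ^ j) * (1 - \<eta> ^ (n - j)) = (\<i> * (\<theta> ^ j - inverse \<theta> ^ j)) ^ 2"
      unfolding 1 2 3 t_def[symmetric] power_mult_distrib
      using t by (simp add: field_simps power2_eq_square)
  qed simp
  also have "\<dots> = W ^ 2" unfolding W_def by (rule prod_power_distrib[symmetric])
  finally have "(\<i> * W) ^ 2 = - of_nat n" by (simp add: power_mult_distrib)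
  moreover have "\<i> * W \<in> K"
    using imaginary_unit_K[OF \<open>4 dvd N\<close>] unfolding W_def \<theta>_def \<eta>_def
    by (intro K_mult K_prod K_diff K_power K_inverse K_zeta)
  ultimately show ?thesis using that by blast
qed

text \<open>
  The embeddings commute, so one that fixes one of the three conjugates fixes them all; hence they
  act by even permutations.
\<close>

lemma discriminant_sqrt_Rats:
  assumes S: "S = {a, b, c}" "card S = 3" "S \<subseteq> K" "S \<inter> \<rat> = {}"
    and stable: "\<And>w s. w \<in> R \<Longrightarrow> s \<in> S \<Longrightarrow> emb w s \<in> S"
  shows "(a - b) * (b - c) * (c - a) \<in> \<rat>"
proof (rule fixed_imp_Rats)
  have K: "a \<in> K" "b \<in> K" "c \<in> K" using S by auto
  have d: "a \<noteq> b" "b \<noteq> c" "a \<noteq> c" using S(2) unfolding S(1) by (auto simp: card_insert_if split: if_splits)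
  show "(a - b) * (b - c) * (c - a) \<in> K" using K by blast
  fix w assume w: "w \<in> R"
  \<comment> \<open>As \<open>s\<close> is irrational, some \<open>emb v\<close> moves it. By
    \<open>emb_commute\<close> the image is fixed by \<open>emb w\<close> as well, and injectivity
    forces the third element to stay in place.\<close>
  have all_fixed: "emb w t = t" if st: "s \<in> S" "emb w s = s" "t \<in> S" for s t
  proof -
    have sK: "s \<in> K" "s \<notin> \<rat>" using st S by auto
    then obtain v where v: "v \<in> R" "emb v s \<noteq> s" using fixed_imp_Rats by blast
    define u where "u = emb v s"
    have u: "u \<in> S" "u \<noteq> s" "u \<in> K" using v st stable S by (auto simp: u_def)
    have wu: "emb w u = u" using emb_commute[OF w v(1) sK(1)] st(2) by (simp add: u_def)
    show ?thesis
    proof (cases "t = s \<or> t = u")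
      case True
      thus ?thesis using st wu by auto
    next
      case False
      hence "{s, u, t} = S" using st u S(1,2) by (intro card_seteq) auto
      moreover have "emb w t \<in> S" using stable w st by blast
      moreover have "emb w t \<noteq> s" "emb w t \<noteq> u"
        using emb_inj[OF w, of t s] emb_inj[OF w, of t u] False st wu u S by auto
      ultimately show ?thesis by blast
    qed
  qed
  have ia: "emb w a \<in> {a, b, c}" "emb w b \<in> {a, b, c}" "emb w c \<in> {a, b, c}"
    using stable[OF w] S(1) by auto
  have inj: "emb w a \<noteq> emb w b" "emb w b \<noteq> emb w c" "emb w a \<noteq> emb w c"
    using emb_inj[OF w] K d by auto
  have fx: "emb w s = s \<Longrightarrow> emb w a = a \<and> emb w b = b \<and> emb w c = c" if "s \<in> {a, b, c}" for s
    using all_fixed[of s] that S(1) by auto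
  \<comment> \<open>A transposition would fix exactly one element, so only the identity and the two
    3-cycles remain.\<close>
  have "(emb w a = a \<and> emb w b = b \<and> emb w c = c) \<or> (emb w a = b \<and> emb w b = c \<and> emb w c = a) \<or>
      (emb w a = c \<and> emb w b = a \<and> emb w c = b)"
    using ia inj d fx[of a] fx[of b] fx[of c] by (smt (verit) insert_iff singletonD)
  moreover have "emb w ((a - b) * (b - c) * (c - a)) =
      (emb w a - emb w b) * (emb w b - emb w c) * (emb w c - emb w a)"
    using w K by (simp add: emb_mult emb_diff K_mult K_diff)
  ultimately show "emb w ((a - b) * (b - c) * (c - a)) = (a - b) * (b - c) * (c - a)"
    by (elim disjE conjE) (simp_all add: mult_ac)
qed

text \<open>Cardano's formula, with \<open>\<omega>\<close> a primitive cube root of unity, puts all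
  three roots \<open>a\<close>, \<open>b\<close>, \<open>c\<close> of \<open>g\<close> into
  \<open>K\<close>. Then \<open>discriminant_sqrt_Rats\<close> contradicts the hypothesis on
  squares.\<close>

lemma no_cubic_root:
  fixes k :: int
  assumes \<delta>: "\<delta> \<in> K" "\<delta> * cnj \<delta> = of_int k" "\<delta> ^ 3 + cnj \<delta> ^ 3 = 9"
    and \<omega>: "\<omega> \<in> K" "\<omega> ^ 2 + \<omega> + 1 = 0"
    and k: "k \<noteq> 2" "k \<noteq> 4" and nonsquare: "\<And>a. a ^ 2 \<noteq> 3 * (4 * k ^ 3 - 81)"
  shows False
proof -
  define \<epsilon> where "\<epsilon> = cnj \<delta>"
  have de: "\<delta> * \<epsilon> = of_int k" "\<delta> ^ 3 + \<epsilon> ^ 3 = 9" using \<delta> by (simp_all add: \<epsilon>_def)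
  have \<epsilon>K: "\<epsilon> \<in> K" unfolding \<epsilon>_def using \<delta>(1) by (rule K_cnj)
  define a where "a = \<delta> + \<epsilon>"
  define b where "b = \<omega> * \<delta> + \<omega> ^ 2 * \<epsilon>"
  define c where "c = \<omega> ^ 2 * \<delta> + \<omega> * \<epsilon>"
  define D where "D = (a - b) * (b - c) * (c - a)"
  define g where "g = (\<lambda>x :: complex. x ^ 3 - 3 * of_int k * x - 9)"
  have g: "(x - a) * (x - b) * (x - c) = g x" for x
    unfolding g_def de[symmetric] a_def b_def c_def using \<omega>(2) by Groebner_Basis.algebra
  \<comment> \<open>The discriminant of \<open>g\<close>, which the sum and product of the cubes of
    \<open>\<delta>\<close> and \<open>\<epsilon>\<close> then express through
    \<open>k\<close>.\<close>
  have "D ^ 2 = - 27 * (\<delta> ^ 3 - \<epsilon> ^ 3) ^ 2"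
    unfolding D_def a_def b_def c_def using \<omega>(2) by Groebner_Basis.algebra
  also have "(\<delta> ^ 3 - \<epsilon> ^ 3) ^ 2 = (\<delta> ^ 3 + \<epsilon> ^ 3) ^ 2 - 4 * (\<delta> * \<epsilon>) ^ 3" by Groebner_Basis.algebra
  also have "- 27 * \<dots> = of_int (27 * (4 * k ^ 3 - 81))" by (simp add: de)
  finally have D2: "D ^ 2 = of_int (27 * (4 * k ^ 3 - 81))" .
  have "D \<noteq> 0"
  proof
    assume "D = 0"
    hence "27 * (4 * k ^ 3 - 81) = 0" using D2 by (metis of_int_eq_0_iff power_zero_numeral)
    thus False using nonsquare[of 0] by simp
  qed
  define S where "S = {a, b, c}"
  have SK: "S \<subseteq> K" using \<delta>(1) \<epsilon>K \<omega>(1) unfolding S_def a_def b_def c_def by auto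
  have "D \<in> \<rat>"
    unfolding D_def
  proof (rule discriminant_sqrt_Rats[OF S_def _ SK])
    show "card S = 3" using \<open>D \<noteq> 0\<close> by (auto simp: D_def S_def card_insert_if)
    have root: "g s = 0" if "s \<in> S" for s using that g[of s] by (auto simp: S_def)
    \<comment> \<open>A rational root is an integer \<open>t = 3 * u\<close> with
      \<open>u * (3 * u ^ 2 - k) = 1\<close>, so \<open>u\<close> is 1 or -1 and \<open>k\<close> is
      2 or 4, both excluded.\<close>
    show "S \<inter> \<rat> = {}"
    proof (rule ccontr)
      assume "S \<inter> \<rat> \<noteq> {}"
      then obtain s where s: "s \<in> S" "s \<in> \<rat>" by auto
      have "algebraic_int s"
      proof (rule algebraic_int_root)
        show "algebraic_int (9 :: complex)" by (rule int_imp_algebraic_int) simp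
        show "poly [:0, - 3 * of_int k, 0, 1:] s = 9"
          using root[OF s(1)] by (simp add: g_def algebra_simps power3_eq_cube)
      qed (auto simp: coeff_pCons split: nat.splits)
      then obtain t where t: "s = of_int t" using rational_algebraic_int_is_int s(2) by (auto elim: Ints_cases)
      have "of_int (t ^ 3 - 3 * k * t - 9) = (0 :: complex)" using root[OF s(1)] by (simp add: g_def t)
      hence eq: "t ^ 3 - 3 * k * t - 9 = 0" by (simp only: of_int_eq_0_iff)
      hence "t ^ 3 = 3 * (k * t + 3)" by simp
      hence "3 dvd t ^ 3" by (metis dvd_triv_left)
      hence "3 dvd t" by (rule prime_dvd_power[rotated]) (simp add: prime_int_numeral_eq)
      then obtain u where u: "t = 3 * u" by (elim dvdE)
      have "9 * (u * (3 * u ^ 2 - k)) = 9" using eq unfolding u by (simp add: algebra_simps power2_eq_square power3_eq_cube)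
      hence u1: "u * (3 * u ^ 2 - k) = 1" by simp
      hence "u = 1 \<or> u = -1" using zmult_eq_1_iff by blast
      with u1 k show False by auto
    qed
    fix w s assume w: "w \<in> R" and s: "s \<in> S"
    have "s \<in> K" using s SK by auto
    hence "emb w (g s) = g (emb w s)"
      unfolding g_def using w by (simp add: emb_diff emb_mult emb_power K_diff K_mult K_power)
    hence "g (emb w s) = 0" using root[OF s] w by simp
    thus "emb w s \<in> S" unfolding g[symmetric] by (auto simp: S_def)
  qed
  \<comment> \<open>Division by 3 turns the factor 27 in \<open>D ^ 2\<close> into the factor 3 of
    \<open>nonsquare\<close>; being rational and integral, the quotient is an integer.\<close>
  hence "D / 3 \<in> \<rat>" by simp
  moreover have "algebraic_int (D / 3)"
  proof (rule algebraic_int_root)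
    show "algebraic_int (of_int (3 * (4 * k ^ 3 - 81)) :: complex)" by (rule algebraic_int_of_int)
    show "poly (monom 1 2) (D / 3) = of_int (3 * (4 * k ^ 3 - 81))"
      using D2 by (simp add: poly_monom power_divide)
  qed (auto simp: degree_monom_eq)
  ultimately have "D / 3 \<in> \<int>" by (intro rational_algebraic_int_is_int)
  then obtain e where "D / 3 = of_int e" by (rule Ints_cases)
  hence "of_int (e ^ 2) = (D / 3) ^ 2" by simp
  also have "\<dots> = of_int (3 * (4 * k ^ 3 - 81))" using D2 by (simp add: power_divide)
  finally have "e ^ 2 = 3 * (4 * k ^ 3 - 81)" by (simp only: of_int_eq_iff)
  with nonsquare show False by blast
qed

end

section \<open>Passage to a larger cyclotomic field\<close>

lemma primitive_root_of_unity_cis: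
  assumes "N > 0"
  shows "primitive_root_of_unity N (cis (2 * pi / real N))"
proof -
  have bij: "bij_betw (\<lambda>k. cis (2 * pi * real k / real N)) {..<N} {z. z ^ N = 1}"
    using assms by (rule bij_betw_roots_unity)
  have pow: "cis (2 * pi / real N) ^ k = cis (2 * pi * real k / real N)" for k
    by (simp add: Complex.DeMoivre mult_ac)
  have "cis (2 * pi / real N) ^ k \<noteq> 1" if "0 < k" "k < N" for k
  proof
    assume "cis (2 * pi / real N) ^ k = 1"
    hence "cis (2 * pi * real k / real N) = cis (2 * pi * real 0 / real N)" by (simp add: pow)
    hence "k = 0" using that assms by (intro inj_onD[OF bij_betw_imp_inj_on[OF bij]]) auto
    with that show False by simp
  qed
  moreover have "cis (2 * pi / real N) ^ N = 1" using assms by (simp add: pow)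
  ultimately show ?thesis using assms by (simp add: primitive_root_of_unity_def)
qed

context cyclotomic begin

lemma K_subset_cyclotomic:
  assumes "cyclotomic M \<xi>" "N dvd M"
  shows "K \<subseteq> cyclotomic.K \<xi>"
proof
  interpret M: cyclotomic M \<xi> by (rule assms)
  obtain q where "M = N * q" using assms(2) by (elim dvdE)
  hence "\<zeta> ^ M = 1" by (simp add: power_mult)
  hence z: "\<zeta> \<in> M.K" by (rule M.root_of_unity_K)
  fix x assume "x \<in> K"
  then obtain P where P: "x = reval P \<zeta>" by (rule K_cases)
  have "reval P \<zeta> \<in> M.K" using z by (induction P) auto
  thus "x \<in> M.K" by (simp add: P)
qed

lemma not_unit_times_cube:
  fixes k :: int
  assumes \<alpha>: "\<alpha> \<in> K" "\<alpha> * cnj \<alpha> = of_int k ^ 3" "\<alpha> + cnj \<alpha> = 9"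
    and k: "k > 4" and nonsquare: "\<And>a. a ^ 2 \<noteq> 3 * (4 * k ^ 3 - 81)"
    and v: "v \<in> K" "algebraic_int v" "algebraic_int (inverse v)" and c: "c \<in> K"
  shows "\<alpha> \<noteq> v * c ^ 3"
proof
  assume eq: "\<alpha> = v * c ^ 3"
  have nz: "\<alpha> \<noteq> 0" using \<alpha>(3) by auto
  hence vc: "v \<noteq> 0" "c \<noteq> 0" using eq by auto
  define u where "u = v / cnj v"
  have u: "u \<noteq> 0" using vc by (simp add: u_def)
  obtain t where t: "t > 0" "u ^ t = 1"
    unfolding u_def by (rule unit_quotient_cnj_root_of_unity[OF v vc(1)])
  have "card {q. q ^ 3 = u} = 3" using u by (intro card_nth_roots) auto
  then obtain q where q: "q ^ 3 = u" by (metis (mono_tags, lifting) Collect_empty_eq card.empty zero_neq_numeral)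
  \<comment> \<open>The factor \<open>N\<close> keeps \<open>K\<close> inside, \<open>3 * t\<close>
    admits the cube root \<open>q\<close> of \<open>u\<close>, and the 3 also provides a primitive
    cube root of unity.\<close>
  define M where "M = 3 * t * N"
  define \<xi> where "\<xi> = cis (2 * pi / real M)"
  have M: "M > 0" using t N_pos by (simp add: M_def)
  interpret M: cyclotomic M \<xi>
    unfolding \<xi>_def by unfold_locales (rule primitive_root_of_unity_cis[OF M])
  have sub: "K \<subseteq> M.K" by (rule K_subset_cyclotomic) (unfold_locales, simp add: M_def)
  have "q ^ M = ((q ^ 3) ^ t) ^ N" by (simp add: M_def power_mult)
  hence "q ^ M = 1" using t(2) q by simp
  hence qM: "q \<in> M.K" by (rule M.root_of_unity_K)
  \<comment> \<open>Chosen so that \<open>\<alpha> ^ 2 = \<delta>' ^ 3\<close>; then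
    \<open>\<alpha> = \<alpha> ^ 3 / \<alpha> ^ 2\<close> is the cube of
    \<open>\<alpha> / \<delta>'\<close>.\<close>
  define \<delta>' where "\<delta>' = q * of_int k * c / cnj c"
  have \<delta>'M: "\<delta>' \<in> M.K" unfolding \<delta>'_def using qM c sub by (intro M.K_divide M.K_mult M.K_cnj) auto
  have "\<alpha> ^ 2 * cnj \<alpha> = \<alpha> * of_int k ^ 3" using \<alpha>(2) by (simp add: power2_eq_square mult.assoc)
  also have "\<dots> = \<delta>' ^ 3 * cnj \<alpha>"
    using vc by (simp add: \<delta>'_def eq power_mult_distrib power_divide q u_def)
  finally have sq: "\<alpha> ^ 2 = \<delta>' ^ 3" using nz by simp
  define \<delta> where "\<delta> = \<alpha> / \<delta>'"
  have \<delta>M: "\<delta> \<in> M.K" unfolding \<delta>_def using \<alpha>(1) sub \<delta>'M by auto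
  have cube: "\<delta> ^ 3 = \<alpha>"
    unfolding \<delta>_def power_divide sq[symmetric] using nz by (simp add: power3_eq_cube power2_eq_square)
  \<comment> \<open>Both sides are nonnegative reals with the same cube
    \<open>k ^ 3\<close>.\<close>
  have norm: "\<delta> * cnj \<delta> = of_int k"
  proof -
    have "complex_of_real ((cmod \<delta> ^ 2) ^ 3) = (\<delta> * cnj \<delta>) ^ 3"
      unfolding complex_norm_square[symmetric] by (simp only: of_real_power)
    also have "\<dots> = \<alpha> * cnj \<alpha>" by (simp add: power_mult_distrib cube flip: complex_cnj_power)
    also have "\<dots> = complex_of_real (real_of_int k ^ 3)" by (simp add: \<alpha>(2))
    finally have "(cmod \<delta> ^ 2) ^ 3 = real_of_int k ^ 3" by (simp only: of_real_eq_iff)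
    hence "cmod \<delta> ^ 2 = real_of_int k" using k by (subst (asm) power_eq_iff_eq_base) auto
    thus ?thesis by (metis complex_norm_square of_real_of_int_eq)
  qed
  define \<omega> where "\<omega> = \<xi> ^ (M div 3)"
  have "primitive_root_of_unity 3 \<omega>"
    unfolding \<omega>_def by (rule M.primitive_root_power) (simp add: M_def)
  hence "\<omega> ^ 3 = 1" "\<omega> ^ 1 \<noteq> 1" unfolding primitive_root_of_unity_def by (blast, force)
  moreover have "(\<omega> - 1) * (\<omega> ^ 2 + \<omega> + 1) = \<omega> ^ 3 - 1" by Groebner_Basis.algebra
  ultimately have "\<omega> ^ 2 + \<omega> + 1 = 0" by simp
  moreover have "\<omega> \<in> M.K" unfolding \<omega>_def by auto
  moreover have "\<delta> ^ 3 + cnj \<delta> ^ 3 = 9" using \<alpha>(3) by (simp add: cube flip: complex_cnj_power)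
  ultimately show False using M.no_cubic_root[OF \<delta>M norm] k nonsquare by auto
qed

end

section \<open>The ideal class group\<close>

text \<open>The orbits \<open>{x, f x, f (f x)}\<close> partition \<open>A\<close> into triples:
  \<open>f (f x) = x\<close> would give \<open>x = f x\<close> on applying \<open>f\<close>. For
  infinite \<open>A\<close> the cardinality is 0 by convention.\<close>

lemma three_dvd_card_of_free_action:
  assumes f: "\<And>x. x \<in> A \<Longrightarrow> f x \<in> A" "\<And>x. x \<in> A \<Longrightarrow> f (f (f x)) = x"
    and free: "\<And>x. x \<in> A \<Longrightarrow> f x \<noteq> x"
  shows "3 dvd card A"
proof (cases "finite A")
  case True
  define orb where "orb = (\<lambda>x. {x, f x, f (f x)})"
  have A: "\<Union> (orb ` A) = A" using f(1) by (auto simp: orb_def)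
  have orb_eq: "orb y = orb x" if "x \<in> A" "y \<in> orb x" for x y
    using that f by (auto simp: orb_def)
  have "3 dvd card (\<Union> (orb ` A))"
  proof (rule dvd_partition)
    show "finite (\<Union> (orb ` A))" using True A by simp
    show "\<forall>c\<in>orb ` A. 3 dvd card c"
    proof clarify
      fix x assume x: "x \<in> A"
      hence "f x \<noteq> x" "f (f x) \<noteq> f x" "f (f x) \<noteq> x"
        using free[of x] free[of "f x"] f(1)[of x] f(2)[of x] by auto
      hence "card (orb x) = 3" by (simp add: orb_def card_insert_if)
      thus "3 dvd card (orb x)" by simp
    qed
    show "\<forall>c1\<in>orb ` A. \<forall>c2\<in>orb ` A. c1 \<noteq> c2 \<longrightarrow> c1 \<inter> c2 = {}"
    proof clarify
      fix x y assume xy: "x \<in> A" "y \<in> A" "orb x \<noteq> orb y"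
      show "orb x \<inter> orb y = {}"
      proof (rule ccontr)
        assume "orb x \<inter> orb y \<noteq> {}"
        then obtain z where "z \<in> orb x" "z \<in> orb y" by blast
        with xy orb_eq[of x z] orb_eq[of y z] show False by simp
      qed
    qed
  qed
  thus ?thesis by (simp add: A)
qed simp

lemma complex_field_simps [simp]:
  "carrier complex_field = UNIV" "x \<otimes>\<^bsub>complex_field\<^esub> y = x * y" "x \<oplus>\<^bsub>complex_field\<^esub> y = x + y"
  "\<one>\<^bsub>complex_field\<^esub> = 1" "\<zero>\<^bsub>complex_field\<^esub> = 0"
  by (simp_all add: complex_field_def ring_of_type_algebra_def)

interpretation CF: cring complex_field
  unfolding complex_field_def by (rule cring_from_type_algebra)

lemma complex_field_uminus [simp]: "\<ominus>\<^bsub>complex_field\<^esub> x = - x"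
  by (rule CF.minus_equality) simp_all

lemma complex_field_inv [simp]: "x \<noteq> 0 \<Longrightarrow> inv\<^bsub>complex_field\<^esub> x = inverse x"
  by (rule CF.comm_inv_char) simp_all

context cyclotomic begin

lemma rationals_adjoin_eq: "rationals_adjoin \<zeta> = K"
proof
  show "rationals_adjoin \<zeta> \<subseteq> K"
  proof
    fix x assume "x \<in> rationals_adjoin \<zeta>"
    thus "x \<in> K" unfolding rationals_adjoin_def
      by (induction rule: generate_field.induct) auto
  qed
  let ?F = "generate_field complex_field {\<zeta>}"
  have add: "x + y \<in> ?F" if "x \<in> ?F" "y \<in> ?F" for x y
    using generate_field.eng_add[OF that] by simp
  have mult: "x * y \<in> ?F" if "x \<in> ?F" "y \<in> ?F" for x y
    using generate_field.eng_mult[OF that] by simp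
  have minus: "- x \<in> ?F" if "x \<in> ?F" for x
    using generate_field.a_inv[OF that] by simp
  have one: "1 \<in> ?F" using generate_field.one[of complex_field "{\<zeta>}"] by simp
  have zero: "0 \<in> ?F" using add[OF one minus[OF one]] by simp
  have inv: "inverse x \<in> ?F" if "x \<in> ?F" for x
    using generate_field.m_inv[OF that] zero by (cases "x = 0") auto
  have nat: "of_nat n \<in> ?F" for n by (induction n) (auto intro: zero one add)
  have int: "of_int i \<in> ?F" for i by (cases i) (auto simp del: of_nat_Suc intro: nat minus)
  have rat: "of_rat c \<in> ?F" for c
    by (cases c) (auto simp: of_rat_rat divide_inverse intro: int mult inv)
  have zeta: "\<zeta> \<in> ?F" by (rule generate_field.incl) simp
  have "reval P \<zeta> \<in> ?F" for P by (induction P) (auto intro: zero add mult rat zeta)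
  thus "K \<subseteq> rationals_adjoin \<zeta>" by (auto simp: K_def rationals_adjoin_def)
qed

section \<open>Fractional ideals and their classes\<close>

definition OK :: "complex set" where "OK = {x \<in> K. algebraic_int x}"

lemma OK_add: "x \<in> OK \<Longrightarrow> y \<in> OK \<Longrightarrow> x + y \<in> OK"
  and OK_mult: "x \<in> OK \<Longrightarrow> y \<in> OK \<Longrightarrow> x * y \<in> OK"
  and OK_minus: "x \<in> OK \<Longrightarrow> - x \<in> OK"
  and OK_of_int: "of_int i \<in> OK"
  by (auto simp: OK_def intro: algebraic_int_add algebraic_int_mult)

lemma OK_1: "1 \<in> OK"
  using OK_of_int[of 1] by simp

lemma ring_of_integers_eq: "ring_of_integers K = complex_field \<lparr>carrier := OK\<rparr>"
  by (simp add: ring_of_integers_def OK_def)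

lemma ring_of_integers_simps [simp]:
  "carrier (ring_of_integers K) = OK" "x \<otimes>\<^bsub>ring_of_integers K\<^esub> y = x * y"
  "x \<oplus>\<^bsub>ring_of_integers K\<^esub> y = x + y" "\<one>\<^bsub>ring_of_integers K\<^esub> = 1" "\<zero>\<^bsub>ring_of_integers K\<^esub> = 0"
  using complex_field_simps by (simp_all add: ring_of_integers_eq)

lemma ring_ring_of_integers: "ring (ring_of_integers K)"
  unfolding ring_of_integers_eq
  by (intro CF.subring_is_ring CF.subringI)
     (auto intro: OK_add OK_mult OK_minus OK_1)

lemma ideal_iff:
  "ideal J (ring_of_integers K) \<longleftrightarrow>
     J \<subseteq> OK \<and> 0 \<in> J \<and> (\<forall>x\<in>J. \<forall>y\<in>J. x + y \<in> J) \<and> (\<forall>a\<in>OK. \<forall>x\<in>J. a * x \<in> J)"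
  (is "?L \<longleftrightarrow> ?R")
proof
  assume ?L
  then interpret ideal J "ring_of_integers K" .
  show ?R using a_subset additive_subgroup.a_closed[OF is_additive_subgroup] I_l_closed
      additive_subgroup.zero_closed[OF is_additive_subgroup]
    by auto
next
  assume R: ?R
  interpret OK: ring "ring_of_integers K" by (rule ring_ring_of_integers)
  show ?L
  proof (rule idealI)
    show "ring (ring_of_integers K)" by (rule ring_ring_of_integers)
    show "subgroup J (add_monoid (ring_of_integers K))"
    proof (rule OK.add.subgroupI)
      fix x assume x: "x \<in> J"
      have "\<ominus>\<^bsub>ring_of_integers K\<^esub> x = - x"
        using x R OK_minus by (intro OK.minus_equality) auto
      moreover have "- 1 * x \<in> J" using R x OK_minus[OF OK_1] by blast
      ultimately show "\<ominus>\<^bsub>ring_of_integers K\<^esub> x \<in> J" by simp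
    qed (use R in auto)
    fix a x assume "a \<in> J" "x \<in> carrier (ring_of_integers K)"
    hence "x * a \<in> J" using R by simp
    thus "x \<otimes>\<^bsub>ring_of_integers K\<^esub> a \<in> J" "a \<otimes>\<^bsub>ring_of_integers K\<^esub> x \<in> J"
      by (simp_all add: mult.commute)
  qed
qed

text \<open>Multiplication by the denominator \<open>d\<close> passes between the two descriptions.
  The intrinsic one can be checked for a new set, such as \<open>T J\<close> below, without
  exhibiting the underlying integral ideal.\<close>

lemma fractional_ideals_iff:
  "J \<in> fractional_ideals K \<longleftrightarrow>
     J \<subseteq> K \<and> 0 \<in> J \<and> J \<noteq> {0} \<and> (\<forall>x\<in>J. \<forall>y\<in>J. x + y \<in> J) \<and> (\<forall>a\<in>OK. \<forall>x\<in>J. a * x \<in> J) \<and>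
     (\<exists>d\<in>OK - {0}. \<forall>x\<in>J. d * x \<in> OK)"
  (is "?L \<longleftrightarrow> ?R")
proof
  assume ?L
  then obtain d I where d: "d \<in> OK" "d \<noteq> 0" and I: "ideal I (ring_of_integers K)" "I \<noteq> {0}"
    and J: "J = (\<lambda>x. x / d) ` I"
    unfolding fractional_ideals_def by auto
  note I' = I(1)[unfolded ideal_iff]
  have I_J: "x \<in> J \<longleftrightarrow> x * d \<in> I" for x using d(2) by (force simp: J)
  have "J \<subseteq> K" using I' d by (auto simp: J OK_def)
  moreover have "0 \<in> J" using I' by (simp add: I_J)
  moreover have "J \<noteq> {0}" 
  proof -
    obtain x where "x \<in> I" "x \<noteq> 0" using I(2) I' by auto
    hence "x / d \<in> J" "x / d \<noteq> 0" using d(2) by (auto simp: I_J)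
    thus ?thesis by auto
  qed
  moreover have "d * x \<in> OK" if "x \<in> J" for x using that I' by (auto simp: I_J mult.commute)
  moreover have "\<exists>d\<in>OK - {0}. \<forall>x\<in>J. d * x \<in> OK"
    using d calculation(4) by blast
  ultimately show ?R using I' by (simp add: I_J ring_distribs mult.assoc)
next
  assume R: ?R
  then obtain d where d: "d \<in> OK" "d \<noteq> 0" "\<And>x. x \<in> J \<Longrightarrow> d * x \<in> OK" by blast
  define I where "I = (\<lambda>x. d * x) ` J"
  have "ideal I (ring_of_integers K)"
    unfolding ideal_iff
  proof (intro conjI ballI)
    show "I \<subseteq> OK" using d(3) by (auto simp: I_def)
    show "0 \<in> I" using R by (auto simp: I_def intro!: image_eqI[of _ _ 0])
    fix x y assume "x \<in> I" "y \<in> I"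
    then obtain x' y' where "x = d * x'" "y = d * y'" "x' \<in> J" "y' \<in> J" by (auto simp: I_def)
    thus "x + y \<in> I" using R unfolding I_def by (intro image_eqI[of _ _ "x' + y'"]) (auto simp: ring_distribs)
  next
    fix a x assume "a \<in> OK" "x \<in> I"
    then obtain x' where "x = d * x'" "x' \<in> J" by (auto simp: I_def)
    thus "a * x \<in> I" using R \<open>a \<in> OK\<close> unfolding I_def
      by (intro image_eqI[of _ _ "a * x'"]) auto
  qed
  moreover have "I \<noteq> {0}"
  proof -
    obtain x where "x \<in> J" "x \<noteq> 0" using R by blast
    hence "d * x \<in> I" "d * x \<noteq> 0" using d(2) by (auto simp: I_def)
    thus ?thesis by blast
  qed
  moreover have "J = (\<lambda>x. x / d) ` I" using d(2) by (force simp: I_def image_image)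
  ultimately show ?L using d unfolding fractional_ideals_def by auto
qed

text \<open>The coset of \<open>J\<close> modulo principal ideals, by
  \<open>principal_coset_eq\<close>. In this form, an operation on ideals that commutes with scaling
  acts on classes by direct image.\<close>

definition ideal_class :: "complex set \<Rightarrow> complex set set" where
  "ideal_class J = (\<lambda>c. (\<lambda>x. c * x) ` J) ` (K - {0})"

text \<open>The product of \<open>c OK\<close> and \<open>J\<close> is \<open>c J\<close>:
  absorption by \<open>OK\<close> gives one inclusion, the factor \<open>c * 1\<close> the
  other.\<close>

lemma principal_coset_eq:
  assumes J: "J \<in> fractional_ideals K"
  shows "principal_fractional_ideals K #>\<^bsub>fractional_ideal_group K\<^esub> J = ideal_class J"
proof -
  note J' = J[unfolded fractional_ideals_iff]
  have "ideal_prod complex_field ((\<lambda>x. c * x) ` OK) J = (\<lambda>x. c * x) ` J" for c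
  proof
    show "ideal_prod complex_field ((\<lambda>x. c * x) ` OK) J \<subseteq> (\<lambda>x. c * x) ` J"
    proof
      fix z assume "z \<in> ideal_prod complex_field ((\<lambda>x. c * x) ` OK) J"
      thus "z \<in> (\<lambda>x. c * x) ` J"
      proof (induction rule: ideal_prod.induct)
        case (prod i j)
        then obtain a where "a \<in> OK" "i = c * a" by auto
        thus ?case using prod J' by (intro image_eqI[of _ _ "a * j"]) auto
      next
        case (sum s1 s2)
        then obtain x y where "x \<in> J" "y \<in> J" "s1 = c * x" "s2 = c * y" by auto
        thus ?case using J' by (intro image_eqI[of _ _ "x + y"]) (auto simp: ring_distribs)
      qed
    qed
    show "(\<lambda>x. c * x) ` J \<subseteq> ideal_prod complex_field ((\<lambda>x. c * x) ` OK) J"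
    proof clarify
      fix x assume x: "x \<in> J"
      have "(c * 1) \<otimes>\<^bsub>complex_field\<^esub> x \<in> ideal_prod complex_field ((\<lambda>x. c * x) ` OK) J"
        using x OK_1 by (intro ideal_prod.prod) auto
      thus "c * x \<in> ideal_prod complex_field ((\<lambda>x. c * x) ` OK) J" by simp
    qed
  qed
  hence "principal_fractional_ideals K #>\<^bsub>fractional_ideal_group K\<^esub> J =
      (\<Union>c\<in>K - {0}. {(\<lambda>x. c * x) ` J})"
    unfolding r_coset_def principal_fractional_ideals_def fractional_ideal_group_def by auto
  thus ?thesis by (auto simp: ideal_class_def)
qed

lemma class_number_eq: "class_number K = card (ideal_class ` fractional_ideals K)"
proof -
  have "carrier (ideal_class_group K) = ideal_class ` fractional_ideals K"
    unfolding ideal_class_group_def FactGroup_def RCOSETS_def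
    using principal_coset_eq by (auto simp: fractional_ideal_group_def)
  thus ?thesis by (simp add: class_number_def Coset.order_def)
qed

text \<open>For a nonzero \<open>y\<close> in \<open>J\<close> and a common denominator
  \<open>d\<close> of \<open>J\<close>, every \<open>d * y * x ^ n\<close> is integral, so
  \<open>x\<close> is almost integral.\<close>

lemma stabilizer_integral:
  assumes J: "J \<in> fractional_ideals K" and x: "x \<in> K" "\<And>y. y \<in> J \<Longrightarrow> x * y \<in> J"
  shows "algebraic_int x"
proof -
  note J' = J[unfolded fractional_ideals_iff]
  obtain y where y: "y \<in> J" "y \<noteq> 0" using J' by blast
  obtain d where d: "d \<in> OK" "d \<noteq> 0" "\<And>y. y \<in> J \<Longrightarrow> d * y \<in> OK" using J' by blast
  have pow: "x ^ n * y \<in> J" for n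
    by (induction n) (use y x(2) in \<open>auto simp: mult.assoc\<close>)
  have int: "algebraic_int (d * y * x ^ n)" for n
    using d(3)[OF pow[of n]] by (simp add: OK_def mult_ac)
  show ?thesis
    using x(1) int[of 0] d(2) y(2) int by (intro almost_integral_imp_algebraic_int[of x "d * y"]) auto
qed

text \<open>
  Below, \<open>T\<close> is multiplication by the ideal generated by \<open>k\<close> and \<open>\<alpha>\<close>. Its cube is generated by \<open>\<alpha>\<close>,
  since \<open>k\<close> and the trace 9 are coprime. If infinitely many classes existed, \<open>card\<close> would be 0.
\<close>

lemma three_dvd_class_number:
  fixes k :: int
  assumes \<alpha>: "\<alpha> \<in> K" "\<alpha> * cnj \<alpha> = of_int k ^ 3" "\<alpha> + cnj \<alpha> = 9"
    and k: "coprime k 3" "k \<noteq> 0"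
    and no_cube: "\<And>v c. v \<in> K \<Longrightarrow> algebraic_int v \<Longrightarrow> algebraic_int (inverse v) \<Longrightarrow> c \<in> K \<Longrightarrow> \<alpha> \<noteq> v * c ^ 3"
  shows "3 dvd class_number K"
proof -
  have \<alpha>0: "\<alpha> \<noteq> 0" using \<alpha>(2) k(2) by auto
  have "\<alpha> ^ 2 - 9 * \<alpha> + of_int (k ^ 3) = 0"
    using \<alpha>(2) unfolding \<alpha>(3)[symmetric] by (simp add: algebra_simps power2_eq_square)
  hence "algebraic_int \<alpha>"
    by (intro algebraic_int.intros[of "[:of_int (k ^ 3), - 9, 1:]"])
       (auto simp: coeff_pCons algebra_simps power2_eq_square split: nat.splits)
  hence \<alpha>O: "\<alpha> \<in> OK" "cnj \<alpha> \<in> OK" using \<alpha>(1) by (auto simp: OK_def)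
  have kO: "of_int k \<in> OK" by (rule OK_of_int)
  \<comment> \<open>One pair \<open>x\<close>, \<open>y\<close> covers all finite sums, because a
    fractional ideal is closed under addition and under \<open>OK\<close>.\<close>
  define T where "T = (\<lambda>J. {of_int k * x + \<alpha> * y | x y. x \<in> J \<and> y \<in> J})"
  define sc where "sc = (\<lambda>(c :: complex) J. (\<lambda>x. c * x) ` J)"
  have TI: "of_int k * x + \<alpha> * y \<in> T J" if "x \<in> J" "y \<in> J" for x y J
    using that by (auto simp: T_def)
  have TE: "\<exists>x\<in>J. \<exists>y\<in>J. z = of_int k * x + \<alpha> * y" if "z \<in> T J" for z J
    using that by (auto simp: T_def)
  have T_sc: "T (sc c J) = sc c (T J)" for c J
    unfolding T_def sc_def by (force simp: algebra_simps)
  have T_frac: "T J \<in> fractional_ideals K" if J: "J \<in> fractional_ideals K" for J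
  proof -
    note J' = J[unfolded fractional_ideals_iff]
    obtain d where d: "d \<in> OK - {0}" "\<And>x. x \<in> J \<Longrightarrow> d * x \<in> OK" using J' by blast
    show ?thesis
      unfolding fractional_ideals_iff
    proof (intro conjI ballI bexI[OF _ d(1)])
      show "T J \<subseteq> K"
      proof
        fix z assume "z \<in> T J"
        then obtain x y where "x \<in> J" "y \<in> J" "z = of_int k * x + \<alpha> * y" using TE by blast
        moreover from this have "x \<in> K" "y \<in> K" using J' by auto
        ultimately show "z \<in> K" using \<alpha>(1) by blast
      qed
      have J0: "0 \<in> J" using J' by blast
      show "0 \<in> T J" using TI[OF J0 J0] by simp
      obtain y where y: "y \<in> J" "y \<noteq> 0" using J' by blast
      have "of_int k * y \<in> T J" using TI[OF y(1) J0] by simp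
      moreover have "of_int k * y \<noteq> 0" using y(2) k(2) by simp
      ultimately show "T J \<noteq> {0}" by blast
    next
      fix z z' assume "z \<in> T J" "z' \<in> T J"
      then obtain x y x' y' where "x \<in> J" "y \<in> J" "x' \<in> J" "y' \<in> J"
        "z = of_int k * x + \<alpha> * y" "z' = of_int k * x' + \<alpha> * y'" by (metis TE)
      thus "z + z' \<in> T J" using TI[of "x + x'" J "y + y'"] J' by (simp add: algebra_simps)
    next
      fix a z assume "a \<in> OK" "z \<in> T J"
      moreover from this obtain x y where "x \<in> J" "y \<in> J" "z = of_int k * x + \<alpha> * y" by (metis TE)
      ultimately show "a * z \<in> T J" using TI[of "a * x" J "a * y"] J' by (simp add: algebra_simps)
    next
      fix z assume "z \<in> T J"
      then obtain x y where xy: "x \<in> J" "y \<in> J" "z = of_int k * x + \<alpha> * y" by (metis TE)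
      have "of_int k * (d * x) + \<alpha> * (d * y) \<in> OK"
        by (rule OK_add; rule OK_mult; intro kO \<alpha>O d(2) xy)
      thus "d * z \<in> OK" by (simp add: xy(3) algebra_simps)
    qed
  qed
  \<comment> \<open>This Bezout identity, multiplied by \<open>\<alpha>\<close>, will exhibit
    \<open>\<alpha>\<close> in the cube of the ideal generated by \<open>k\<close> and
    \<open>\<alpha>\<close>.\<close>
  obtain a b where ab: "a * 81 + b * k ^ 2 = 1"
  proof -
    have "coprime (k ^ 2) (3 ^ 4)"
      using k(1) by (simp only: coprime_power_left_iff coprime_power_right_iff) simp
    hence "gcd 81 (k ^ 2) = 1" by (simp add: coprime_iff_gcd_eq_1 gcd.commute)
    thus ?thesis using that bezout_int[of 81 "k ^ 2"] by auto
  qed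
  have T3: "T (T (T J)) = sc \<alpha> J" if J: "J \<in> fractional_ideals K" for J
  proof
    note J' = J[unfolded fractional_ideals_iff]
    have add: "x + y \<in> J" if "x \<in> J" "y \<in> J" for x y using J' that by blast
    have mult: "c * x \<in> J" if "c \<in> OK" "x \<in> J" for c x using J' that by blast
    show "T (T (T J)) \<subseteq> sc \<alpha> J"
    proof
      fix z assume "z \<in> T (T (T J))"
      then obtain z1 z2 where z12: "z1 \<in> T (T J)" "z2 \<in> T (T J)" "z = of_int k * z1 + \<alpha> * z2"
        using TE by blast
      obtain y1 y2 where y12: "y1 \<in> T J" "y2 \<in> T J" "z1 = of_int k * y1 + \<alpha> * y2"
        using TE[OF z12(1)] by blast
      obtain y3 y4 where y34: "y3 \<in> T J" "y4 \<in> T J" "z2 = of_int k * y3 + \<alpha> * y4"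
        using TE[OF z12(2)] by blast
      obtain x1 x2 where x12: "x1 \<in> J" "x2 \<in> J" "y1 = of_int k * x1 + \<alpha> * x2"
        using TE[OF y12(1)] by blast
      obtain x3 x4 where x34: "x3 \<in> J" "x4 \<in> J" "y2 = of_int k * x3 + \<alpha> * x4"
        using TE[OF y12(2)] by blast
      obtain x5 x6 where x56: "x5 \<in> J" "x6 \<in> J" "y3 = of_int k * x5 + \<alpha> * x6"
        using TE[OF y34(1)] by blast
      obtain x7 x8 where x78: "x7 \<in> J" "x8 \<in> J" "y4 = of_int k * x7 + \<alpha> * x8"
        using TE[OF y34(2)] by blast
      note z = z12(3) y12(3) y34(3) x12(3) x34(3) x56(3) x78(3)
      note x = x12(1,2) x34(1,2) x56(1,2) x78(1,2)
      \<comment> \<open>Each of the eight threefold products of \<open>k\<close> and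
        \<open>\<alpha>\<close> is divisible by \<open>\<alpha>\<close>, \<open>k ^ 3\<close> being
        \<open>\<alpha> * cnj \<alpha>\<close>; \<open>y\<close> collects the quotients.\<close>
      define y where "y = cnj \<alpha> * x1 + of_int k * (of_int k * (x2 + x3 + x5) + \<alpha> * (x4 + x6 + x7)) + \<alpha> * (\<alpha> * x8)"
      have "y \<in> J" unfolding y_def by (intro add mult x \<alpha>O kO)
      moreover have "z = \<alpha> * y" unfolding z y_def using \<alpha>(2) by Groebner_Basis.algebra
      ultimately show "z \<in> sc \<alpha> J" by (auto simp: sc_def)
    qed
    show "sc \<alpha> J \<subseteq> T (T (T J))"
    proof
      fix z assume "z \<in> sc \<alpha> J"
      then obtain x where x: "x \<in> J" "z = \<alpha> * x" by (auto simp: sc_def)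
      have J0: "0 \<in> J" using J' by blast
      \<comment> \<open>Only \<open>k ^ 3\<close>, \<open>k ^ 2 * \<alpha>\<close> and
        \<open>\<alpha> ^ 3\<close> are used, with coefficients \<open>x1\<close>,
        \<open>b * x\<close> and \<open>a * x\<close>. Trace 9 gives
        \<open>cnj \<alpha> * (18 - cnj \<alpha>) + \<alpha> ^ 2 = 81\<close>, so the total is
        \<open>\<alpha> * (a * 81 + b * k ^ 2) * x\<close>.\<close>
      define x1 where "x1 = of_int a * ((of_int 18 + - cnj \<alpha>) * x)"
      have xJ: "x1 \<in> J" "of_int b * x \<in> J" "of_int a * x \<in> J"
        unfolding x1_def by (intro mult x(1) OK_of_int OK_add[OF OK_of_int OK_minus[OF \<alpha>O(2)]])+
      have "of_int (a * 81 + b * k ^ 2) = (1 :: complex)" by (simp only: ab of_int_1)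
      hence ab': "of_int a * 81 + of_int b * of_int k ^ 2 = (1 :: complex)" by simp
      have "z = of_int k * (of_int k * (of_int k * x1 + \<alpha> * (of_int b * x)) + \<alpha> * (of_int k * 0 + \<alpha> * 0)) +
          \<alpha> * (of_int k * (of_int k * 0 + \<alpha> * 0) + \<alpha> * (of_int k * 0 + \<alpha> * (of_int a * x)))"
      proof -
        have "cnj \<alpha> = 9 - \<alpha>" using \<alpha>(3) by (simp add: algebra_simps)
        thus ?thesis using \<alpha>(2) ab' unfolding x(2) x1_def of_int_numeral by Groebner_Basis.algebra
      qed
      also have "\<dots> \<in> T (T (T J))" by (intro TI xJ J0)
      finally show "z \<in> T (T (T J))" .
    qed
  qed
  have sc_sc: "sc c (sc d J) = sc (c * d) J" for c d J
    unfolding sc_def image_image by (rule image_cong) (simp_all add: mult.assoc)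
  have class_eq: "ideal_class J = (\<lambda>d. sc d J) ` (K - {0})" for J
    by (simp add: ideal_class_def sc_def)
  have class_sc: "ideal_class (sc c J) = ideal_class J" if c: "c \<in> K - {0}" for c J
  proof -
    have "(\<lambda>d. d * c) ` (K - {0}) = K - {0}"
    proof
      show "K - {0} \<subseteq> (\<lambda>d. d * c) ` (K - {0})"
      proof
        fix d assume "d \<in> K - {0}"
        thus "d \<in> (\<lambda>d. d * c) ` (K - {0})" using c by (intro image_eqI[of _ _ "d / c"]) auto
      qed
    qed (use c in auto)
    moreover have "ideal_class (sc c J) = (\<lambda>d. sc d J) ` ((\<lambda>d. d * c) ` (K - {0}))"
      unfolding class_eq sc_sc image_image ..
    ultimately show ?thesis by (simp add: class_eq)
  qed
  have image_class: "(`) T (ideal_class J) = ideal_class (T J)" for J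
    unfolding ideal_class_def image_image using T_sc by (auto simp: sc_def)
  show ?thesis unfolding class_number_eq
  proof (rule three_dvd_card_of_free_action[where f = "(`) T"])
    fix C assume "C \<in> ideal_class ` fractional_ideals K"
    then obtain J where J: "J \<in> fractional_ideals K" "C = ideal_class J" by auto
    show "T ` C \<in> ideal_class ` fractional_ideals K"
      using J T_frac by (auto simp: image_class)
    show "T ` T ` T ` C = C"
      using J class_sc[of \<alpha>] \<alpha>(1) \<alpha>0 by (simp add: image_class T3)
    show "T ` C \<noteq> C"
    proof
      assume "T ` C = C"
      hence "ideal_class (T J) = ideal_class J" by (simp add: J image_class)
      moreover have "T J \<in> ideal_class (T J)"
        unfolding ideal_class_def by (rule image_eqI[of _ _ 1]) auto
      ultimately obtain c where c: "c \<in> K" "c \<noteq> 0" "T J = sc c J"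
        by (auto simp: ideal_class_def sc_def)
      \<comment> \<open>Iterating \<open>T J = sc c J\<close> three times yields the scaling by
        \<open>c ^ 3\<close>, to be compared with \<open>T3\<close>.\<close>
      have "sc \<alpha> J = sc (c ^ 3) J"
        using T3[OF J(1)] by (simp add: c(3) T_sc sc_sc power3_eq_cube mult.assoc)
      define v where "v = \<alpha> / c ^ 3"
      have "v \<in> K" using \<alpha>(1) c unfolding v_def by auto
      moreover have "algebraic_int v"
      proof (rule stabilizer_integral[OF J(1) \<open>v \<in> K\<close>])
        fix y assume "y \<in> J"
        hence "\<alpha> * y \<in> sc (c ^ 3) J" using \<open>sc \<alpha> J = sc (c ^ 3) J\<close> by (auto simp: sc_def)
        thus "v * y \<in> J" using c by (auto simp: sc_def v_def)
      qed
      moreover have "algebraic_int (inverse v)"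
      proof (rule stabilizer_integral[OF J(1) K_inverse[OF \<open>v \<in> K\<close>]])
        fix y assume "y \<in> J"
        hence "c ^ 3 * y \<in> sc \<alpha> J" using \<open>sc \<alpha> J = sc (c ^ 3) J\<close> by (auto simp: sc_def)
        thus "inverse v * y \<in> J" using \<alpha>0 c by (auto simp: sc_def v_def)
      qed
      moreover have "\<alpha> = v * c ^ 3" using c by (simp add: v_def)
      ultimately show False using no_cube c(1) by blast
    qed
  qed
qed

end

section \<open>Application to the field of \<open>4 * m\<close>-th roots of unity\<close>

theorem theorem4:
  fixes r m :: int and \<zeta> :: complex
  assumes "r > 1"
    and "m = 324 * r ^ 3 + 324 * r ^ 2 + 108 * r - 231"
    and "primitive_root_of_unity (nat (4 * m)) \<zeta>"
  shows "3 dvd class_number (rationals_adjoin \<zeta>)"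
proof -
  define k where "k = 3 * r + 1"
  define n where "n = nat (4 * k ^ 3 - 81)"
  \<comment> \<open>The bound makes \<open>4 * k ^ 3 - 81\<close> positive and avoids
    \<open>k = 2\<close> and \<open>k = 4\<close>, where the cubic has the root 3 or -3.\<close>
  have k: "k > 4" using assms(1) by (simp add: k_def)
  have "k ^ 3 \<ge> 5 ^ 3" using k by (intro power_mono) auto
  hence n: "int n = 4 * k ^ 3 - 81" unfolding n_def by simp
  have m: "m = 3 * (4 * k ^ 3 - 81)"
    unfolding assms(2) k_def by (simp add: algebra_simps power2_eq_square power3_eq_cube)
  have N: "nat (4 * m) = 4 * n * 3" using n unfolding m by simp
  interpret cyclotomic "4 * n * 3" \<zeta> by unfold_locales (use assms(3) N in simp)
  have "odd (int n)" unfolding n by simp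
  hence "odd n" by simp
  then obtain x where x: "x \<in> K" "x ^ 2 = - of_nat n" by (rule sqrt_neg_odd_K) simp
  define \<alpha> where "\<alpha> = (9 + x) / 2"
  have "n > 0" using n \<open>k ^ 3 \<ge> 5 ^ 3\<close> by (intro Nat.gr0I) auto
  \<comment> \<open>The square of \<open>x\<close> is a negative real, so \<open>x\<close> is purely
    imaginary and conjugation negates it.\<close>
  have "Re x = 0"
  proof -
    have "Re (x ^ 2) = - real n" "Im (x ^ 2) = 0" by (simp_all add: x(2))
    hence *: "Re x ^ 2 - Im x ^ 2 = - real n" "Re x = 0 \<or> Im x = 0"
      by (auto simp: power2_eq_square)
    have "Im x \<noteq> 0"
    proof
      assume "Im x = 0"
      hence "Re x ^ 2 < 0" using *(1) \<open>n > 0\<close> by simp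
      thus False by simp
    qed
    thus ?thesis using *(2) by simp
  qed
  hence cnj_x: "cnj x = - x" by (simp add: complex_eq_iff)
  have \<alpha>K: "\<alpha> \<in> K" unfolding \<alpha>_def using x(1) by auto
  have "\<alpha> * cnj \<alpha> = (81 - x ^ 2) / 4"
    by (simp add: \<alpha>_def cnj_x algebra_simps power2_eq_square)
  also have "\<dots> = of_int (81 + int n) / 4" by (simp add: x(2))
  also have "\<dots> = of_int k ^ 3" by (simp add: n)
  finally have norm: "\<alpha> * cnj \<alpha> = of_int k ^ 3" .
  have trace: "\<alpha> + cnj \<alpha> = 9" by (simp add: \<alpha>_def cnj_x field_simps)
  \<comment> \<open>A square divisible by 3 is divisible by 9, but \<open>4 * k ^ 3 - 81\<close> is
    1 modulo 3.\<close>
  have nonsquare: "a ^ 2 \<noteq> 3 * (4 * k ^ 3 - 81)" for a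
  proof
    assume a: "a ^ 2 = 3 * (4 * k ^ 3 - 81)"
    hence "3 dvd a ^ 2" by simp
    hence "3 dvd a" by (rule prime_dvd_power[rotated]) (simp add: prime_int_numeral_eq)
    then obtain b where "a = 3 * b" by (elim dvdE)
    with a have "3 * b ^ 2 = 4 * k ^ 3 - 81" by (simp add: power2_eq_square)
    also have "\<dots> = 3 * (36 * r ^ 3 + 36 * r ^ 2 + 12 * r - 26) + 1"
      by (simp add: k_def algebra_simps power2_eq_square power3_eq_cube)
    finally show False by presburger
  qed
  have "coprime k 3"
    unfolding k_def by (subst coprime_commute) (simp add: prime_imp_coprime prime_int_numeral_eq dvd_add_right_iff)
  hence "3 dvd class_number K"
    using three_dvd_class_number[OF \<alpha>K norm trace] k
      not_unit_times_cube[OF \<alpha>K norm trace k nonsquare] by auto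
  thus ?thesis by (simp add: rationals_adjoin_eq)
qed

end
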